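(* Let $t_0\ge 0$ and let $a,b,g,h:[0,\infty)\to\mathbb R$ be Lebesgue measurable functions such that $a,b$ are essentially bounded on $[0,\infty)$; $\operatorname{ess\,sup}_{t\ge t_0}|a(t)|\le a_0$ for some constant $a_0<1$; $b(t)\ge 0$; $g(t)\le t$, $h(t)\le t$, $\lim_{t\to\infty}g(t)=\lim_{t\to\infty}h(t)=\infty$; the set $g^{-1}(E)$ has Lebesgue measure zero whenever $E\subset\mathbb R$ has Lebesgue measure zero; and $t-g(t)\le\delta$, $t-h(t)\le\tau$ for $t\ge t_0$ with some constants $\delta>0$, $\tau>0$. Assume that $b(t)\ge\beta>0$ for $t\ge t_0$ with a constant $\beta$, and that at least one of the following conditions holds: a) $$\left\|\frac{a}{b_0}\right\|_{[t_0,\infty)}\frac{\|b\|_{[t_0,\infty)}}{1-\|a\|_{[t_0,\infty)}}+\left\|\frac{b-b_0}{b_0}\right\|_{[t_0,\infty)}<1,\quad\text{where } b_0(t)=\min\left\{b(t),\frac1{\tau e}\right\};$$ b) $$\|b\|_{[t_0,\infty)}\left(\left\|\frac ab\right\|_{[t_0,\infty)}+\left\|\left(t-h(t)-\frac{1}{\|b\|_{[t_0,\infty)}e}\right)^+\right\|_{[t_0,\infty)}\right)<1-\|a\|_{[t_0,\infty)}.$$ Then the equation $\dot x(t)-a(t)\dot x(g(t))+b(t)x(h(t))=0$ is exponentially stable.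
   Context: Notation: $\|f\|_{[t_0,\infty)}=\operatorname{ess\,sup}_{t\ge t_0}|f(t)|$ (an expression in $t$ inside the norm denotes the corresponding function of $t$); $u^+=\max\{u,0\}$. Solutions: for an initial point $\sigma\ge t_0$ and bounded Borel measurable functions $\varphi:(-\infty,\sigma]\to\mathbb R$, $\psi:(-\infty,\sigma)\to\mathbb R$ (prescribed independently of each other), a solution of the equation with initial conditions $x(t)=\varphi(t)$ for $t\le\sigma$, $\dot x(t)=\psi(t)$ for $t<\sigma$ is a function $x$ that is absolutely continuous on each $[\sigma,c]$, has locally essentially bounded derivative on $[\sigma,\infty)$, and satisfies the equation for almost all $t\ge\sigma$, where $x$ at arguments $\le\sigma$ is replaced by $\varphi$ and $\dot x$ at arguments $<\sigma$ is replaced by $\psi$. The equation is (uniformly) exponentially stable if there exist $M>0$, $\gamma>0$, not depending on $\sigma\ge t_0$, $\varphi$, $\psi$, such that every such solution satisfies $|x(t)|\le M e^{-\gamma(t-\sigma)}\sup_{s\le\sigma}(|\varphi(s)|+|\psi(s)|)$ for $t\ge\sigma$ (with $\psi(\sigma):=0$). *)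

theory Defs
  imports "HOL-Analysis.Analysis" "HOL-Probability.Essential_Supremum"
begin

definition essentially_bounded_on :: "real set \<Rightarrow> (real \<Rightarrow> real) \<Rightarrow> bool" where
  "essentially_bounded_on S f \<longleftrightarrow> (\<exists>K. AE t in lebesgue_on S. \<bar>f t\<bar> \<le> K)"

text \<open>The essential supremum is taken in the extended reals and then converted, so the value is
  meaningful only for measurable functions that are essentially bounded on the half-line
  (otherwise it is the junk value 0).\<close>

definition ess_norm :: "real \<Rightarrow> (real \<Rightarrow> real) \<Rightarrow> real" where
  "ess_norm t0 f = real_of_ereal (esssup (lebesgue_on {t0..}) (\<lambda>t. ereal \<bar>f t\<bar>))"

text \<open>A finite system of non-overlapping intervals is encoded by the set of pairs of end points;
  a degenerate pair contributes nothing to either sum.\<close>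

definition absolutely_continuous_on :: "real set \<Rightarrow> (real \<Rightarrow> real) \<Rightarrow> bool" where
  "absolutely_continuous_on S f \<longleftrightarrow>
     (\<forall>\<epsilon>>0. \<exists>\<eta>>0. \<forall>D :: (real \<times> real) set.
        finite D \<longrightarrow>
        (\<forall>(u, v)\<in>D. u \<le> v \<and> {u..v} \<subseteq> S) \<longrightarrow>
        disjoint_family_on (\<lambda>(u, v). {u<..<v}) D \<longrightarrow>
        (\<Sum>(u, v)\<in>D. v - u) < \<eta> \<longrightarrow>
        (\<Sum>(u, v)\<in>D. \<bar>f v - f u\<bar>) < \<epsilon>)"

text \<open>The function \<open>x\<close> is the solution glued to its initial function, \<open>x = \<phi>\<close> on \<open>(-\<infinity>, \<sigma>]\<close>, whereas
  the prescribed initial derivative \<open>\<psi>\<close> need not be the derivative of \<open>\<phi>\<close>. The value of \<open>deriv x\<close>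
  is unspecified at points of non-differentiability and at \<open>\<sigma>\<close> may depend on \<open>\<phi>\<close>; in the setting
  of the theorem the argument \<open>g t\<close> hits this exceptional null set only for a null set of
  times \<open>t\<close>. Almost everywhere differentiability is part of having a locally essentially bounded
  derivative (and follows from absolute continuity).\<close>

definition solution_derivative ::
  "real \<Rightarrow> (real \<Rightarrow> real) \<Rightarrow> (real \<Rightarrow> real) \<Rightarrow> real \<Rightarrow> real" where
  "solution_derivative \<sigma> \<psi> x t = (if t < \<sigma> then \<psi> t else deriv x t)"

definition neutral_solution ::
  "(real \<Rightarrow> real) \<Rightarrow> (real \<Rightarrow> real) \<Rightarrow> (real \<Rightarrow> real) \<Rightarrow> (real \<Rightarrow> real) \<Rightarrow>
   real \<Rightarrow> (real \<Rightarrow> real) \<Rightarrow> (real \<Rightarrow> real) \<Rightarrow> (real \<Rightarrow> real) \<Rightarrow> bool" where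
  "neutral_solution a b g h \<sigma> \<phi> \<psi> x \<longleftrightarrow>
     (\<forall>t\<le>\<sigma>. x t = \<phi> t) \<and>
     (\<forall>c>\<sigma>. absolutely_continuous_on {\<sigma>..c} x) \<and>
     (AE t in lebesgue_on {\<sigma>..}. x differentiable (at t)) \<and>
     (\<forall>c>\<sigma>. essentially_bounded_on {\<sigma>..c} (deriv x)) \<and>
     (AE t in lebesgue_on {\<sigma>..}.
        deriv x t - a t * solution_derivative \<sigma> \<psi> x (g t) + b t * x (h t) = 0)"

definition initial_functions :: "real \<Rightarrow> (real \<Rightarrow> real) \<Rightarrow> (real \<Rightarrow> real) \<Rightarrow> bool" where
  "initial_functions \<sigma> \<phi> \<psi> \<longleftrightarrow>
     \<phi> \<in> borel_measurable (restrict_space borel {..\<sigma>}) \<and> bounded (\<phi> ` {..\<sigma>}) \<and>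
     \<psi> \<in> borel_measurable (restrict_space borel {..<\<sigma>}) \<and> bounded (\<psi> ` {..<\<sigma>})"

definition initial_size :: "real \<Rightarrow> (real \<Rightarrow> real) \<Rightarrow> (real \<Rightarrow> real) \<Rightarrow> real" where
  "initial_size \<sigma> \<phi> \<psi> = (SUP s\<in>{..\<sigma>}. \<bar>\<phi> s\<bar> + (if s < \<sigma> then \<bar>\<psi> s\<bar> else 0))"

definition neutral_exponentially_stable ::
  "real \<Rightarrow> (real \<Rightarrow> real) \<Rightarrow> (real \<Rightarrow> real) \<Rightarrow> (real \<Rightarrow> real) \<Rightarrow> (real \<Rightarrow> real) \<Rightarrow> bool" where
  "neutral_exponentially_stable t0 a b g h \<longleftrightarrow>
     (\<exists>M>0. \<exists>\<gamma>>0. \<forall>\<sigma>\<ge>t0. \<forall>\<phi> \<psi> x.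
        initial_functions \<sigma> \<phi> \<psi> \<longrightarrow> neutral_solution a b g h \<sigma> \<phi> \<psi> x \<longrightarrow>
        (\<forall>t\<ge>\<sigma>. \<bar>x t\<bar> \<le> M * exp (- \<gamma> * (t - \<sigma>)) * initial_size \<sigma> \<phi> \<psi>))"

end

theory Submission
  imports Defs
begin

text \<open>For a scalar delay equation \<open>y' + c y(H) = c u\<close> with \<open>c \<theta> \<le> 1/e\<close>, where \<open>\<theta>\<close> bounds the delay
  \<open>t - H t\<close>, solutions with a constant nonnegative prehistory and \<open>u \<ge> 0\<close> are nonnegative; comparing \<open>y\<close> with
  the constants \<open>\<plusminus>K\<close> gives \<open>\<bar>y\<bar> \<le> K\<close> whenever \<open>\<bar>u\<bar> \<le> K\<close>.
  The neutral equation is brought into this form for \<open>y t = exp (\<lambda> (t - \<sigma>)) * x t\<close> with a small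
  \<open>\<lambda> > 0\<close>: the coefficient \<open>b\<close> is cut down to some \<open>c \<le> b\<close>, and the delayed argument \<open>h t\<close> is moved up to
  \<open>max (h t) (t - \<theta>)\<close>. The resulting errors, together with the neutral term, are estimated by the
  essential supremum \<open>V\<close> of \<open>exp (\<lambda> (t - \<sigma>)) * \<bar>x'\<bar>\<close>, and the equation itself bounds \<open>V\<close> by about
  \<open>\<parallel>b\<parallel> / (1 - \<parallel>a\<parallel>)\<close> times the supremum \<open>Y\<close> of \<open>\<bar>y\<bar>\<close>. The smallness condition turns this into
  \<open>Y \<le> F Y + C I\<close> with \<open>F < 1\<close>, where \<open>I\<close> is the size of the initial data. Condition (a) is the case
  \<open>\<theta> = \<tau>\<close>, \<open>c = b\<^sub>0\<close>, and condition (b) the case \<open>\<theta> = 1 / (\<parallel>b\<parallel> e)\<close>, \<open>c = b\<close>.\<close>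

section \<open>Absolutely continuous functions\<close>

lemma absolutely_continuous_onE:
  assumes "absolutely_continuous_on S f" "\<epsilon> > 0"
  obtains \<eta> where "\<eta> > 0" "\<And>D. finite D \<Longrightarrow> (\<forall>(u, v)\<in>D. u \<le> v \<and> {u..v} \<subseteq> S) \<Longrightarrow>
        disjoint_family_on (\<lambda>(u, v). {u<..<v}) D \<Longrightarrow>
        (\<Sum>(u, v)\<in>D. v - u) < \<eta> \<Longrightarrow> (\<Sum>(u, v)\<in>D. \<bar>f v - f u\<bar>) < \<epsilon>"
proof -
  from assms obtain \<eta> where "\<eta> > 0" and *: "\<forall>D. finite D \<longrightarrow>
        (\<forall>(u, v)\<in>D. u \<le> v \<and> {u..v} \<subseteq> S) \<longrightarrow>
        disjoint_family_on (\<lambda>(u, v). {u<..<v}) D \<longrightarrow>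
        (\<Sum>(u, v)\<in>D. v - u) < \<eta> \<longrightarrow> (\<Sum>(u, v)\<in>D. \<bar>f v - f u\<bar>) < \<epsilon>"
    unfolding absolutely_continuous_on_def by blast
  show thesis by (rule that[OF \<open>\<eta> > 0\<close>]) (use * in blast)
qed

lemma absolutely_continuous_on_subset:
  assumes "absolutely_continuous_on S f" "T \<subseteq> S"
  shows "absolutely_continuous_on T f"
  unfolding absolutely_continuous_on_def
proof (intro allI impI)
  fix \<epsilon> :: real assume "\<epsilon> > 0"
  with assms(1) obtain \<eta> where \<eta>: "\<eta> > 0" and D: "\<And>D. finite D \<Longrightarrow> (\<forall>(u, v)\<in>D. u \<le> v \<and> {u..v} \<subseteq> S) \<Longrightarrow>
        disjoint_family_on (\<lambda>(u, v). {u<..<v}) D \<Longrightarrow>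
        (\<Sum>(u, v)\<in>D. v - u) < \<eta> \<Longrightarrow> (\<Sum>(u, v)\<in>D. \<bar>f v - f u\<bar>) < \<epsilon>"
    by (rule absolutely_continuous_onE) blast
  show "\<exists>\<eta>>0. \<forall>D. finite D \<longrightarrow> (\<forall>(u, v)\<in>D. u \<le> v \<and> {u..v} \<subseteq> T) \<longrightarrow>
        disjoint_family_on (\<lambda>(u, v). {u<..<v}) D \<longrightarrow>
        (\<Sum>(u, v)\<in>D. v - u) < \<eta> \<longrightarrow> (\<Sum>(u, v)\<in>D. \<bar>f v - f u\<bar>) < \<epsilon>"
    using \<eta> D assms(2) by (intro exI[of _ \<eta>]) fastforce
qed

text \<open>One closure property serves for all functions built from an absolutely continuous one:
  adding a Lipschitz function, scaling, or multiplying by an exponential weight reduces to an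
  estimate of increments, in which \<open>v - u\<close> absorbs the Lipschitz part.\<close>

lemma absolutely_continuous_on_dominated:
  fixes f F :: "real \<Rightarrow> real"
  assumes f: "absolutely_continuous_on S f"
    and F: "\<And>u v. u \<in> S \<Longrightarrow> v \<in> S \<Longrightarrow> u \<le> v \<Longrightarrow> \<bar>F v - F u\<bar> \<le> C * (\<bar>f v - f u\<bar> + (v - u))"
  shows "absolutely_continuous_on S F"
  unfolding absolutely_continuous_on_def
proof (intro allI impI)
  fix \<epsilon> :: real assume "\<epsilon> > 0"
  \<comment> \<open>Since \<open>C\<close> may fail to be positive, a larger positive constant is
    used; each of the two sums then gets half of the budget.\<close>
  define C' where "C' = max C 1"
  have C': "C' > 0" "C \<le> C'" by (auto simp: C'_def)
  then have "\<epsilon> / (2 * C') > 0" using \<open>\<epsilon> > 0\<close> by simp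
  with f obtain \<eta> where \<eta>: "\<eta> > 0" and D: "\<And>D. finite D \<Longrightarrow> (\<forall>(u, v)\<in>D. u \<le> v \<and> {u..v} \<subseteq> S) \<Longrightarrow>
        disjoint_family_on (\<lambda>(u, v). {u<..<v}) D \<Longrightarrow>
        (\<Sum>(u, v)\<in>D. v - u) < \<eta> \<Longrightarrow> (\<Sum>(u, v)\<in>D. \<bar>f v - f u\<bar>) < \<epsilon> / (2 * C')"
    by (rule absolutely_continuous_onE) blast
  have "(\<Sum>(u, v)\<in>D. \<bar>F v - F u\<bar>) < \<epsilon>"
    if fin: "finite D" and sub: "\<forall>(u, v)\<in>D. u \<le> v \<and> {u..v} \<subseteq> S"
      and dis: "disjoint_family_on (\<lambda>(u, v). {u<..<v}) D"
      and small: "(\<Sum>(u, v)\<in>D. v - u) < min \<eta> (\<epsilon> / (2 * C'))" for D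
  proof -
    have "(\<Sum>(u, v)\<in>D. \<bar>F v - F u\<bar>) \<le> (\<Sum>(u, v)\<in>D. C' * (\<bar>f v - f u\<bar> + (v - u)))"
    proof (intro sum_mono, clarify)
      fix u v assume "(u, v) \<in> D"
      with sub have "u \<le> v" "{u..v} \<subseteq> S" by auto
      then have uv: "u \<le> v" "u \<in> S" "v \<in> S" by auto
      then have "\<bar>F v - F u\<bar> \<le> C * (\<bar>f v - f u\<bar> + (v - u))" by (intro F)
      also have "\<dots> \<le> C' * (\<bar>f v - f u\<bar> + (v - u))"
        using uv C' by (intro mult_right_mono) auto
      finally show "\<bar>F v - F u\<bar> \<le> C' * (\<bar>f v - f u\<bar> + (v - u))" .
    qed
    also have "\<dots> = C' * ((\<Sum>(u, v)\<in>D. \<bar>f v - f u\<bar>) + (\<Sum>(u, v)\<in>D. v - u))"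
      by (simp add: sum_distrib_left sum.distrib[symmetric] case_prod_unfold)
    also have "\<dots> < C' * (\<epsilon> / (2 * C') + \<epsilon> / (2 * C'))"
      using D[OF fin sub dis] small C' by (intro mult_strict_left_mono add_strict_mono) auto
    also have "\<dots> = \<epsilon>" using C' by (simp add: field_simps)
    finally show ?thesis .
  qed
  moreover have "min \<eta> (\<epsilon> / (2 * C')) > 0" using \<eta> \<open>\<epsilon> > 0\<close> C' by simp
  ultimately show "\<exists>\<eta>>0. \<forall>D. finite D \<longrightarrow> (\<forall>(u, v)\<in>D. u \<le> v \<and> {u..v} \<subseteq> S) \<longrightarrow>
        disjoint_family_on (\<lambda>(u, v). {u<..<v}) D \<longrightarrow>
        (\<Sum>(u, v)\<in>D. v - u) < \<eta> \<longrightarrow> (\<Sum>(u, v)\<in>D. \<bar>F v - F u\<bar>) < \<epsilon>"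
    by blast
qed

lemma absolutely_continuous_on_imp_continuous_on:
  assumes f: "absolutely_continuous_on {a..b} f"
  shows "continuous_on {a..b} f"
  unfolding continuous_on_iff
proof (intro ballI allI impI)
  fix x \<epsilon> :: real assume x: "x \<in> {a..b}" and \<epsilon>: "\<epsilon> > 0"
  from f \<epsilon> obtain \<eta> where \<eta>: "\<eta> > 0" and D: "\<And>D. finite D \<Longrightarrow> (\<forall>(u, v)\<in>D. u \<le> v \<and> {u..v} \<subseteq> {a..b}) \<Longrightarrow>
        disjoint_family_on (\<lambda>(u, v). {u<..<v}) D \<Longrightarrow>
        (\<Sum>(u, v)\<in>D. v - u) < \<eta> \<Longrightarrow> (\<Sum>(u, v)\<in>D. \<bar>f v - f u\<bar>) < \<epsilon>"
    by (rule absolutely_continuous_onE) blast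
  have "dist (f y) (f x) < \<epsilon>" if "y \<in> {a..b}" "dist y x < \<eta>" for y
    using D[of "{(min x y, max x y)}"] that x
    by (cases "x \<le> y") (auto simp: disjoint_family_on_def dist_real_def)
  with \<eta> show "\<exists>d>0. \<forall>y\<in>{a..b}. dist y x < d \<longrightarrow> dist (f y) (f x) < \<epsilon>" by blast
qed

text \<open>Around a point where the derivative exists and is nonnegative, a gauge keeps the
  increments above \<open>- \<epsilon>\<close> times the length. All other tags lie in a null set,
  hence in an open \<open>U\<close> of measure below the \<open>\<eta>\<close> of absolute
  continuity; a gauge that stays inside \<open>U\<close> there makes their total increment small.
  Summation over a fine tagged division gives the claim up to \<open>e\<close>.\<close>

lemma absolutely_continuous_on_mono_if_AE_deriv_nonneg:
  fixes f :: "real \<Rightarrow> real"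
  assumes f: "absolutely_continuous_on {a..b} f" and "a \<le> b"
    and deriv: "AE t in lebesgue. t \<in> {a..b} \<longrightarrow> (\<exists>d\<ge>0. (f has_real_derivative d) (at t))"
  shows "f a \<le> f b"
proof (rule field_le_epsilon)
  fix e :: real assume "e > 0"
  \<comment> \<open>Good intervals cost at most \<open>\<epsilon> * (b - a)\<close> and bad ones at
    most \<open>\<epsilon>\<close>, together \<open>e\<close>.\<close>
  define \<epsilon> where "\<epsilon> = e / (1 + (b - a))"
  have \<epsilon>: "\<epsilon> > 0" "\<epsilon> * (1 + (b - a)) = e" using \<open>e > 0\<close> \<open>a \<le> b\<close> by (auto simp: \<epsilon>_def field_simps)
  from f \<epsilon>(1) obtain \<eta> where \<eta>: "\<eta> > 0" and ac: "\<And>D. finite D \<Longrightarrow> (\<forall>(u, v)\<in>D. u \<le> v \<and> {u..v} \<subseteq> {a..b}) \<Longrightarrow>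
        disjoint_family_on (\<lambda>(u, v). {u<..<v}) D \<Longrightarrow>
        (\<Sum>(u, v)\<in>D. v - u) < \<eta> \<Longrightarrow> (\<Sum>(u, v)\<in>D. \<bar>f v - f u\<bar>) < \<epsilon>"
    by (rule absolutely_continuous_onE) blast
  obtain N where good: "\<And>t. t \<notin> N \<Longrightarrow> t \<in> {a..b} \<Longrightarrow> \<exists>d\<ge>0. (f has_real_derivative d) (at t)"
    and N: "N \<in> null_sets lebesgue"
    using AE_E3[OF deriv] by (metis DiffI UNIV_I space_completion space_lborel space_borel)
  obtain U where U: "open U" "N \<subseteq> U" "U - N \<in> lmeasurable" "emeasure lebesgue (U - N) < ennreal \<eta>"
    using sets_lebesgue_outer_open[of N \<eta>] N \<eta> by auto
  have "U \<in> sets lebesgue" using U(1) by simp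
  have emU: "emeasure lebesgue U < ennreal \<eta>"
    using U(4) N \<open>U \<in> sets lebesgue\<close> by (simp add: emeasure_Diff_null_set)
  then have Um: "U \<in> lmeasurable"
    using \<open>U \<in> sets lebesgue\<close> by (intro fmeasurableI) (auto intro: less_trans)
  have mU: "measure lebesgue U < \<eta>"
    using emU \<eta> Um by (simp add: emeasure_eq_measure2 ennreal_less_iff)
  have "\<exists>r>0. (x \<in> {a..b} - N \<longrightarrow> (\<forall>u v. u \<le> x \<and> x \<le> v \<and> {u..v} \<subseteq> ball x r \<longrightarrow> - \<epsilon> * (v - u) \<le> f v - f u))
            \<and> (x \<in> N \<longrightarrow> ball x r \<subseteq> U)" for x
  proof (cases "x \<in> N")
    case True
    then show ?thesis using U open_contains_ball by (metis DiffD2 subsetD)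
  next
    case False
    show ?thesis
    proof (cases "x \<in> {a..b}")
      case True
      with good False obtain d where d: "d \<ge> 0" "(f has_real_derivative d) (at x)" by blast
      from d(2) have "(f has_derivative (\<lambda>h. d * h)) (at x)"
        by (simp add: has_field_derivative_def)
      then obtain r where r: "r > 0" "\<And>y. \<bar>y - x\<bar> < r \<Longrightarrow> \<bar>f y - f x - d * (y - x)\<bar> \<le> \<epsilon> * \<bar>y - x\<bar>"
        using \<epsilon>(1) unfolding has_derivative_at_alt by (metis real_norm_def)
      \<comment> \<open>The tag splits the interval in two; on each piece the error of the linear
        approximation is at most \<open>\<epsilon>\<close> times the length, and the linear part is
        nonnegative because \<open>d \<ge> 0\<close>.\<close>
      have "- \<epsilon> * (v - u) \<le> f v - f u" if "u \<le> x" "x \<le> v" "{u..v} \<subseteq> ball x r" for u v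
      proof -
        have "u \<in> ball x r" "v \<in> ball x r" using that by (auto simp del: mem_ball intro!: subsetD[OF that(3)])
        then have "\<bar>u - x\<bar> < r" "\<bar>v - x\<bar> < r" by (auto simp: dist_real_def)
        from r(2)[OF this(1)] r(2)[OF this(2)] that
        have "- \<epsilon> * (x - u) \<le> f x - f u - d * (x - u)" "- \<epsilon> * (v - x) \<le> f v - f x - d * (v - x)"
          by (auto simp: algebra_simps abs_le_iff)
        moreover have "d * (x - u) \<ge> 0" "d * (v - x) \<ge> 0" using d(1) that by auto
        ultimately show ?thesis by (simp add: algebra_simps)
      qed
      then show ?thesis using r(1) False by blast
    qed (use False in \<open>auto intro: exI[of _ 1]\<close>)
  qed
  then obtain r where r: "\<And>x. r x > 0"
    "\<And>x u v. x \<in> {a..b} - N \<Longrightarrow> u \<le> x \<Longrightarrow> x \<le> v \<Longrightarrow> {u..v} \<subseteq> ball x (r x) \<Longrightarrow> - \<epsilon> * (v - u) \<le> f v - f u"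
    "\<And>x. x \<in> N \<Longrightarrow> ball x (r x) \<subseteq> U" by metis
  have "gauge (\<lambda>x. ball x (r x))" using r(1) by (intro gauge_ball_dependent) auto
  then obtain p where p: "p tagged_division_of {a..b}" "(\<lambda>x. ball x (r x)) fine p"
    by (rule fine_division_exists_real)
  note pD = tagged_division_ofD[OF p(1)]
  have K: "K = {Inf K..Sup K}" "Inf K \<le> x" "x \<le> Sup K" "x \<in> {a..b}" "{Inf K..Sup K} \<subseteq> {a..b}"
     "{Inf K..Sup K} \<subseteq> ball x (r x)" if xK: "(x, K) \<in> p" for x K
  proof -
    obtain u v where "K = {u..v}" using pD(4)[OF xK] by auto
    then show "K = {Inf K..Sup K}" "Inf K \<le> x" "x \<le> Sup K" "x \<in> {a..b}" "{Inf K..Sup K} \<subseteq> {a..b}"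
     "{Inf K..Sup K} \<subseteq> ball x (r x)"
      using pD(2,3)[OF xK] fineD[OF p(2) xK] by auto
  qed
  \<comment> \<open>Degenerate intervals are discarded, since injectivity of the map to end points
    is read off from disjoint nonempty interiors; their increments vanish anyway.\<close>
  define q where "q = {(x, K). (x, K) \<in> p \<and> x \<in> N \<and> Inf K < Sup K}"
  define D where "D = (\<lambda>(x::real, K::real set). (Inf K, Sup K)) ` q"
  have qp: "q \<subseteq> p" by (auto simp: q_def)
  have fq: "finite q" using qp pD(1) finite_subset by blast
  have dj: "{Inf K<..<Sup K} \<inter> {Inf K'<..<Sup K'} = {}"
    if "(x, K) \<in> q" "(x', K') \<in> q" "(x, K) \<noteq> (x', K')" for x K x' K'
  proof -
    have "interior K \<inter> interior K' = {}" using pD(5) that qp by blast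
    moreover have "interior K = {Inf K<..<Sup K}" "interior K' = {Inf K'<..<Sup K'}"
      using K(1) that qp by (metis interior_atLeastAtMost_real subsetD)+
    ultimately show ?thesis by simp
  qed
  have inj: "inj_on (\<lambda>(x::real, K::real set). (Inf K, Sup K)) q"
  proof (rule inj_onI, clarify)
    fix x K x' K' assume *: "(x, K) \<in> q" "(x', K') \<in> q" "Inf K = Inf K'" "Sup K = Sup K'"
    have "{Inf K<..<Sup K} \<noteq> {}" using *(1) by (auto simp: q_def dest: dense)
    then show "x = x' \<and> K = K'" using dj[OF *(1,2)] *(3,4) by auto
  qed
  have fD: "finite D" by (simp add: D_def fq)
  have subD: "\<forall>(u, v)\<in>D. u \<le> v \<and> {u..v} \<subseteq> {a..b}"
    using K(5) by (auto simp: D_def q_def)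
  have disD: "disjoint_family_on (\<lambda>(u, v). {u<..<v}) D"
    unfolding disjoint_family_on_def D_def using dj by (force split: prod.splits)
  have "(\<Sum>(u, v)\<in>D. v - u) = (\<Sum>i\<in>D. measure lebesgue (case i of (u, v) \<Rightarrow> {u<..<v}))"
    using subD by (intro sum.cong) (auto simp: measure_lborel_Ioo split: prod.splits)
  also have "\<dots> = measure lebesgue (\<Union>i\<in>D. case i of (u, v) \<Rightarrow> {u<..<v})"
    using fD disD subD by (intro measure_finite_Union[symmetric]) (auto split: prod.splits)
  also have "\<dots> \<le> measure lebesgue U"
  proof (rule measure_mono_fmeasurable[OF _ _ Um])
    show "(\<Union>i\<in>D. case i of (u, v) \<Rightarrow> {u<..<v}) \<subseteq> U"
    proof clarify
      fix t u v assume "(u, v) \<in> D" and t: "t \<in> {u<..<v}"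
      then obtain x K where xK: "(x, K) \<in> p" "x \<in> N" "u = Inf K" "v = Sup K" by (auto simp: D_def q_def)
      have "t \<in> {Inf K..Sup K}" using t xK by auto
      then show "t \<in> U" using K(6)[OF xK(1)] r(3)[OF xK(2)] by blast
    qed
    have "open (\<Union>i\<in>D. case i of (u, v) \<Rightarrow> {u<..<v})"
      by (intro open_UN) (auto split: prod.splits)
    then show "(\<Union>i\<in>D. case i of (u, v) \<Rightarrow> {u<..<v}) \<in> sets lebesgue" by simp
  qed
  finally have "(\<Sum>(u, v)\<in>D. v - u) < \<eta>" using mU by simp
  from ac[OF fD subD disD this] have "(\<Sum>(u, v)\<in>D. \<bar>f v - f u\<bar>) < \<epsilon>" .
  also have "(\<Sum>(u, v)\<in>D. \<bar>f v - f u\<bar>) = (\<Sum>(x, K)\<in>q. \<bar>f (Sup K) - f (Inf K)\<bar>)"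
    unfolding D_def by (subst sum.reindex[OF inj]) (simp add: case_prod_unfold o_def)
  finally have bad: "(\<Sum>(x, K)\<in>q. \<bar>f (Sup K) - f (Inf K)\<bar>) < \<epsilon>" .
  have "- \<epsilon> * (b - a) - (\<Sum>(x, K)\<in>q. \<bar>f (Sup K) - f (Inf K)\<bar>)
      = (\<Sum>(x, K)\<in>p. - \<epsilon> * (Sup K - Inf K)) - (\<Sum>i\<in>p. if i \<in> q then (case i of (x, K) \<Rightarrow> \<bar>f (Sup K) - f (Inf K)\<bar>) else 0)"
  proof -
    have "(\<Sum>(x, K)\<in>p. - \<epsilon> * (Sup K - Inf K)) = - \<epsilon> * (\<Sum>(x, K)\<in>p. Sup K - Inf K)"
      by (simp add: sum_distrib_left case_prod_unfold)
    also have "\<dots> = - \<epsilon> * (b - a)" using additive_tagged_division_1[OF \<open>a \<le> b\<close> p(1), of "\<lambda>x. x"] by simp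
    finally show ?thesis using sum.inter_restrict[OF pD(1), of _ q] qp by (simp add: Int_absorb1)
  qed
  also have "\<dots> = (\<Sum>i\<in>p. (case i of (x, K) \<Rightarrow> - \<epsilon> * (Sup K - Inf K)) - (if i \<in> q then (case i of (x, K) \<Rightarrow> \<bar>f (Sup K) - f (Inf K)\<bar>) else 0))"
    by (simp add: sum_subtractf)
  \<comment> \<open>Termwise: a bad tag is paid for by its absolute increment, a bad degenerate
    interval has increment zero, and a good tag loses at most \<open>\<epsilon>\<close> times the
    length. The right-hand side telescopes.\<close>
  also have "\<dots> \<le> (\<Sum>(x, K)\<in>p. f (Sup K) - f (Inf K))"
  proof (intro sum_mono)
    fix i assume "i \<in> p"
    moreover obtain x K where i: "i = (x, K)" by fastforce
    ultimately have xK: "(x, K) \<in> p" by simp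
    have le: "Inf K \<le> Sup K" using K(2,3)[OF xK] by linarith
    have e: "- \<epsilon> * (Sup K - Inf K) \<le> 0" using le \<epsilon>(1) by (auto simp: mult_le_0_iff)
    consider "(x, K) \<in> q" | "(x, K) \<notin> q" "x \<in> N" "Inf K = Sup K" | "(x, K) \<notin> q" "x \<notin> N"
      using xK le le_less[of "Inf K" "Sup K"] by (auto simp: q_def)
    then have "- \<epsilon> * (Sup K - Inf K) - (if (x, K) \<in> q then \<bar>f (Sup K) - f (Inf K)\<bar> else 0)
         \<le> f (Sup K) - f (Inf K)"
    proof cases
      case 3
      then show ?thesis using r(2)[of x "Inf K" "Sup K"] K[OF xK] by auto
    qed (use e in auto)
    then show "(case i of (x, K) \<Rightarrow> - \<epsilon> * (Sup K - Inf K)) - (if i \<in> q then (case i of (x, K) \<Rightarrow> \<bar>f (Sup K) - f (Inf K)\<bar>) else 0)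
         \<le> (case i of (x, K) \<Rightarrow> f (Sup K) - f (Inf K))"
      by (simp add: i split: if_splits)
  qed
  also have "\<dots> = f b - f a" by (rule additive_tagged_division_1[OF \<open>a \<le> b\<close> p(1)])
  finally show "f a \<le> f b + e" using bad \<epsilon>(2) by (simp add: algebra_simps)
qed

text \<open>For both signs \<open>s\<close>, the function \<open>L * t - s * f t\<close> is
  nondecreasing, because its derivative \<open>L - s * d\<close> is nonnegative almost
  everywhere.\<close>

lemma lipschitz_if_AE_deriv_bounded:
  fixes f :: "real \<Rightarrow> real"
  assumes f: "absolutely_continuous_on {a..b} f"
    and deriv: "AE t in lebesgue. t \<in> {a..b} \<longrightarrow> (\<exists>d. \<bar>d\<bar> \<le> L \<and> (f has_real_derivative d) (at t))"
    and "a \<le> u" "u \<le> v" "v \<le> b"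
  shows "\<bar>f v - f u\<bar> \<le> L * (v - u)"
proof -
  have sub: "{u..v} \<subseteq> {a..b}" using assms by auto
  have *: "L * u - s * f u \<le> L * v - s * f v" if s: "\<bar>s\<bar> = 1" for s
  proof (rule absolutely_continuous_on_mono_if_AE_deriv_nonneg[where f = "\<lambda>t. L * t - s * f t", OF _ \<open>u \<le> v\<close>])
    show "absolutely_continuous_on {u..v} (\<lambda>t. L * t - s * f t)"
    proof (rule absolutely_continuous_on_dominated[OF absolutely_continuous_on_subset[OF f sub], where C = "max \<bar>L\<bar> 1"])
      fix p q :: real assume "p \<le> q"
      have "\<bar>L * q - s * f q - (L * p - s * f p)\<bar> = \<bar>L * (q - p) - s * (f q - f p)\<bar>"
        by (simp add: algebra_simps)
      also have "\<dots> \<le> \<bar>L\<bar> * (q - p) + \<bar>f q - f p\<bar>"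
        using abs_triangle_ineq4[of "L * (q - p)" "s * (f q - f p)"] \<open>p \<le> q\<close> s by (simp add: abs_mult)
      also have "\<dots> \<le> max \<bar>L\<bar> 1 * (q - p) + max \<bar>L\<bar> 1 * \<bar>f q - f p\<bar>"
        using \<open>p \<le> q\<close> mult_right_mono[of 1 "max \<bar>L\<bar> 1" "\<bar>f q - f p\<bar>"]
        by (intro add_mono mult_right_mono) auto
      finally show "\<bar>L * q - s * f q - (L * p - s * f p)\<bar> \<le> max \<bar>L\<bar> 1 * (\<bar>f q - f p\<bar> + (q - p))"
        by (simp add: algebra_simps)
    qed
    show "AE t in lebesgue. t \<in> {u..v} \<longrightarrow> (\<exists>d\<ge>0. ((\<lambda>t. L * t - s * f t) has_real_derivative d) (at t))"
      using deriv
    proof eventually_elim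
      case (elim t)
      show ?case
      proof
        assume "t \<in> {u..v}"
        with sub elim obtain d where d: "\<bar>d\<bar> \<le> L" "(f has_real_derivative d) (at t)" by blast
        have "\<bar>s * d\<bar> \<le> L" using d(1) s by (simp add: abs_mult)
        then have "L - s * d \<ge> 0" by linarith
        moreover have "((\<lambda>t. L * t - s * f t) has_real_derivative (L - s * d)) (at t)"
          by (rule derivative_eq_intros d(2) refl | simp)+
        ultimately show "\<exists>d\<ge>0. ((\<lambda>t. L * t - s * f t) has_real_derivative d) (at t)" by blast
      qed
    qed
  qed
  from *[of 1] *[of "-1"] show ?thesis by (simp add: algebra_simps abs_le_iff)
qed

section \<open>Delay inequalities\<close>

text \<open>At a maximum point \<open>p\<close> of \<open>P t * exp (t / \<theta>)\<close> on the past, the condition \<open>c \<theta> \<le> 1/e\<close> makes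
  \<open>P\<close> decay after \<open>p\<close> no faster than \<open>exp (- t / \<theta>)\<close>.\<close>

lemma delay_inequality_nonneg:
  fixes P :: "real \<Rightarrow> real"
  assumes P: "absolutely_continuous_on {\<sigma>..T} P" and "\<theta> > 0" and "P \<sigma> \<ge> 0"
    and ineq: "AE t in lebesgue. t \<in> {\<sigma>..T} \<longrightarrow>
      \<sigma> \<le> H t \<and> H t \<le> t \<and> t - H t \<le> \<theta> \<and> 0 \<le> c t \<and> c t \<le> 1 / (\<theta> * exp 1) \<and>
      (\<exists>d. (P has_real_derivative d) (at t) \<and> - c t * P (H t) \<le> d)"
    and t: "t \<in> {\<sigma>..T}"
  shows "P t \<ge> 0"
proof -
  define z where "z s = P s * exp ((s - \<sigma>) / \<theta>)" for s
  have "continuous_on {\<sigma>..t} P"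
    using absolutely_continuous_on_imp_continuous_on[OF P] t by (auto intro: continuous_on_subset)
  then have "continuous_on {\<sigma>..t} z"
    unfolding z_def using \<open>\<theta> > 0\<close> by (intro continuous_intros) auto
  then obtain p where p: "p \<in> {\<sigma>..t}" "\<And>s. s \<in> {\<sigma>..t} \<Longrightarrow> z s \<le> z p"
    using continuous_attains_sup[of "{\<sigma>..t}" z] t by auto
  have zp: "z p \<ge> 0" using p(2)[of \<sigma>] t \<open>P \<sigma> \<ge> 0\<close> by (simp add: z_def)
  \<comment> \<open>The decaying exponential that agrees with \<open>P\<close> at \<open>p\<close>.
    As it is nonnegative, it is enough that \<open>P - E\<close> does not decrease after
    \<open>p\<close>.\<close>
  define E where "E s = z p * exp (- (s - \<sigma>) / \<theta>)" for s
  have E: "(E has_real_derivative (- E s / \<theta>)) (at s)" for s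
    unfolding E_def using \<open>\<theta> > 0\<close> by (auto intro!: derivative_eq_intros simp: field_simps)
  \<comment> \<open>This Lipschitz bound yields absolute continuity of \<open>P - E\<close>.\<close>
  have E_le: "\<bar>E v - E u\<bar> \<le> z p / \<theta> * (v - u)" if "\<sigma> \<le> u" "u \<le> v" for u v
  proof -
    have "norm (E v - E u) \<le> z p / \<theta> * norm (v - u)"
    proof (rule field_differentiable_bound[of "{\<sigma>..}"])
      fix s assume "s \<in> {\<sigma>..}"
      then have "exp (- (s - \<sigma>) / \<theta>) \<le> 1" using \<open>\<theta> > 0\<close> by (auto simp: divide_le_0_iff)
      then have "E s \<le> z p" unfolding E_def using zp by (rule mult_left_le)
      moreover have "E s \<ge> 0" using zp by (simp add: E_def)
      ultimately show "norm (- E s / \<theta>) \<le> z p / \<theta>"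
        using \<open>\<theta> > 0\<close> by (simp add: divide_right_mono)
      show "(E has_real_derivative (- E s / \<theta>)) (at s within {\<sigma>..})"
        by (rule has_field_derivative_at_within[OF E])
    qed (use that in auto)
    then show ?thesis using that by simp
  qed
  have sub: "{p..t} \<subseteq> {\<sigma>..T}" using p t by auto
  have "P p - E p \<le> P t - E t"
  proof (rule absolutely_continuous_on_mono_if_AE_deriv_nonneg[where f = "\<lambda>s. P s - E s"])
    show "absolutely_continuous_on {p..t} (\<lambda>s. P s - E s)"
    proof (rule absolutely_continuous_on_dominated[OF absolutely_continuous_on_subset[OF P sub], where C = "max 1 (z p / \<theta>)"])
      fix u v assume uv: "u \<in> {p..t}" "v \<in> {p..t}" "u \<le> v"
      have "\<bar>P v - E v - (P u - E u)\<bar> \<le> \<bar>P v - P u\<bar> + z p / \<theta> * (v - u)"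
        using E_le[of u v] uv p(1) by auto
      also have "\<dots> \<le> max 1 (z p / \<theta>) * \<bar>P v - P u\<bar> + max 1 (z p / \<theta>) * (v - u)"
        using uv mult_right_mono[of 1 "max 1 (z p / \<theta>)" "\<bar>P v - P u\<bar>"]
        by (intro add_mono mult_right_mono) auto
      finally show "\<bar>P v - E v - (P u - E u)\<bar> \<le> max 1 (z p / \<theta>) * (\<bar>P v - P u\<bar> + (v - u))"
        by (simp add: algebra_simps)
    qed
    show "p \<le> t" using p by simp
    show "AE s in lebesgue. s \<in> {p..t} \<longrightarrow> (\<exists>d\<ge>0. ((\<lambda>s. P s - E s) has_real_derivative d) (at s))"
      using ineq
    proof eventually_elim
      case (elim s)
      show ?case
      proof
        assume s: "s \<in> {p..t}"
        with elim sub obtain d where H: "\<sigma> \<le> H s" "H s \<le> s" "s - H s \<le> \<theta>" and c: "0 \<le> c s" "c s \<le> 1 / (\<theta> * exp 1)"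
          and d: "(P has_real_derivative d) (at s)" "- c s * P (H s) \<le> d" by blast
        \<comment> \<open>Maximality of \<open>z\<close> at \<open>p\<close> and the delay bound
          give \<open>P (H s) \<le> E s * exp 1\<close>; the factor \<open>exp 1\<close> is
          cancelled by \<open>c s \<le> 1 / (\<theta> * exp 1)\<close>, so \<open>P\<close> falls no
          faster than \<open>E\<close>.\<close>
        have "P (H s) = z (H s) * exp (- (H s - \<sigma>) / \<theta>)"
          by (simp add: z_def mult.assoc exp_add[symmetric] add_divide_distrib[symmetric])
        also have "\<dots> \<le> z p * exp (- (H s - \<sigma>) / \<theta>)"
          using p(2)[of "H s"] H s by (intro mult_right_mono) auto
        also have "- (H s - \<sigma>) / \<theta> = - (s - \<sigma>) / \<theta> + (s - H s) / \<theta>"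
          by (simp add: add_divide_distrib[symmetric])
        also have "z p * exp (- (s - \<sigma>) / \<theta> + (s - H s) / \<theta>) \<le> z p * exp (- (s - \<sigma>) / \<theta> + 1)"
          using zp H(3) \<open>\<theta> > 0\<close> by (intro mult_left_mono) auto
        also have "\<dots> = E s * exp 1" by (simp add: E_def exp_add)
        finally have "c s * P (H s) \<le> c s * (E s * exp 1)" using c(1) by (rule mult_left_mono)
        also have "\<dots> \<le> 1 / (\<theta> * exp 1) * (E s * exp 1)"
          using c(2) zp by (intro mult_right_mono) (auto simp: E_def)
        also have "\<dots> = E s / \<theta>" by simp
        finally have "0 \<le> d - (- E s / \<theta>)" using d(2) by simp
        moreover have "((\<lambda>s. P s - E s) has_real_derivative (d - (- E s / \<theta>))) (at s)"
          by (intro DERIV_diff d E)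
        ultimately show "\<exists>d\<ge>0. ((\<lambda>s. P s - E s) has_real_derivative d) (at s)" by blast
      qed
    qed
  qed
  moreover have "P p = E p" by (simp add: E_def z_def mult.assoc exp_add[symmetric] add_divide_distrib[symmetric])
  moreover have "E t \<ge> 0" using zp by (simp add: E_def)
  ultimately show ?thesis by simp
qed

text \<open>The constants \<open>K\<close> and \<open>- K\<close> are barriers: for \<open>s\<close>
  equal to 1 or -1, the function \<open>K - s * y t\<close> satisfies the hypotheses of
  \<open>delay_inequality_nonneg\<close>, because \<open>d + c t * y (H t)\<close> is at most
  \<open>c t * K\<close> in absolute value.\<close>

lemma delay_equation_bound:
  fixes y :: "real \<Rightarrow> real"
  assumes y: "absolutely_continuous_on {\<sigma>..T} y" and "\<theta> > 0" and "\<bar>y \<sigma>\<bar> \<le> K"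
    and eq: "AE t in lebesgue. t \<in> {\<sigma>..T} \<longrightarrow>
      \<sigma> \<le> H t \<and> H t \<le> t \<and> t - H t \<le> \<theta> \<and> 0 \<le> c t \<and> c t \<le> 1 / (\<theta> * exp 1) \<and>
      (\<exists>d. (y has_real_derivative d) (at t) \<and> \<bar>d + c t * y (H t)\<bar> \<le> c t * K)"
    and t: "t \<in> {\<sigma>..T}"
  shows "\<bar>y t\<bar> \<le> K"
proof -
  have *: "0 \<le> K - s * y t" if s: "\<bar>s\<bar> = 1" for s
  proof (rule delay_inequality_nonneg[where P = "\<lambda>t. K - s * y t", OF _ \<open>\<theta> > 0\<close> _ _ t])
    show "absolutely_continuous_on {\<sigma>..T} (\<lambda>t. K - s * y t)"
    proof (rule absolutely_continuous_on_dominated[OF y, where C = 1])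
      fix u v :: real assume "u \<le> v"
      have "\<bar>K - s * y v - (K - s * y u)\<bar> = \<bar>s * (y v - y u)\<bar>"
        by (subst abs_minus_cancel[symmetric]) (simp add: algebra_simps)
      then show "\<bar>K - s * y v - (K - s * y u)\<bar> \<le> 1 * (\<bar>y v - y u\<bar> + (v - u))"
        using s \<open>u \<le> v\<close> by (simp add: abs_mult)
    qed
    have "\<bar>s * y \<sigma>\<bar> \<le> K" using s \<open>\<bar>y \<sigma>\<bar> \<le> K\<close> by (simp add: abs_mult)
    then show "0 \<le> K - s * y \<sigma>" by linarith
    show "AE t in lebesgue. t \<in> {\<sigma>..T} \<longrightarrow>
      \<sigma> \<le> H t \<and> H t \<le> t \<and> t - H t \<le> \<theta> \<and> 0 \<le> c t \<and> c t \<le> 1 / (\<theta> * exp 1) \<and>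
      (\<exists>d. ((\<lambda>t. K - s * y t) has_real_derivative d) (at t) \<and> - c t * (K - s * y (H t)) \<le> d)"
      using eq
    proof eventually_elim
      case (elim t)
      show ?case
      proof
        assume "t \<in> {\<sigma>..T}"
        with elim obtain d where H: "\<sigma> \<le> H t" "H t \<le> t" "t - H t \<le> \<theta>" "0 \<le> c t" "c t \<le> 1 / (\<theta> * exp 1)"
          and d: "(y has_real_derivative d) (at t)" "\<bar>d + c t * y (H t)\<bar> \<le> c t * K" by blast
        have "\<bar>s * (d + c t * y (H t))\<bar> \<le> c t * K" using d(2) s by (simp add: abs_mult)
        then have "- c t * (K - s * y (H t)) \<le> - (s * d)" by (simp add: algebra_simps abs_le_iff)
        moreover have "((\<lambda>t. K - s * y t) has_real_derivative - (s * d)) (at t)"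
          by (rule derivative_eq_intros d(1) refl | simp)+
        ultimately show "\<sigma> \<le> H t \<and> H t \<le> t \<and> t - H t \<le> \<theta> \<and> 0 \<le> c t \<and> c t \<le> 1 / (\<theta> * exp 1) \<and>
          (\<exists>d. ((\<lambda>t. K - s * y t) has_real_derivative d) (at t) \<and> - c t * (K - s * y (H t)) \<le> d)"
          using H by blast
      qed
    qed
  qed
  from *[of 1] *[of "-1"] show ?thesis by (simp add: abs_le_iff)
qed

section \<open>Essential bounds and exponential weights\<close>

lemma AE_lebesgue_on_interval_iff:
  fixes u v :: real
  shows "(AE t in lebesgue_on {u..}. P t) \<longleftrightarrow> (AE t in lebesgue. t \<in> {u..} \<longrightarrow> P t)"
    and "(AE t in lebesgue_on {u..v}. P t) \<longleftrightarrow> (AE t in lebesgue. t \<in> {u..v} \<longrightarrow> P t)"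
  by (simp_all add: AE_restrict_space_iff)

text \<open>The infimum of all nonnegative essential bounds is again one, being approached by
  countably many bounds within \<open>1 / Suc n\<close>. Having a least bound allows an estimate of
  the bound in terms of itself to be solved.\<close>

lemma least_essential_bound:
  fixes f :: "'a \<Rightarrow> real"
  assumes "AE t in M. f t \<le> K"
  obtains V where "V \<ge> 0" "AE t in M. f t \<le> V" "\<And>K. K \<ge> 0 \<Longrightarrow> AE t in M. f t \<le> K \<Longrightarrow> V \<le> K"
proof -
  define S where "S = {K. K \<ge> 0 \<and> (AE t in M. f t \<le> K)}"
  have "max K 0 \<in> S" using assms by (auto simp: S_def elim!: eventually_mono)
  then have ne: "S \<noteq> {}" by blast
  have bd: "bdd_below S" by (auto simp: S_def bdd_below_def)
  have "AE t in M. f t \<le> Inf S + 1 / Suc n" for n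
  proof -
    have "Inf S < Inf S + 1 / Suc n" by simp
    then obtain K where "K \<in> S" "K < Inf S + 1 / Suc n" using cInf_less_iff[OF ne bd] by blast
    then show ?thesis by (auto simp: S_def elim!: eventually_mono)
  qed
  then have "AE t in M. \<forall>n. f t \<le> Inf S + 1 / Suc n" by (simp add: AE_all_countable)
  then have "AE t in M. f t \<le> Inf S"
  proof eventually_elim
    case (elim t)
    show ?case
    proof (rule field_le_epsilon)
      fix e :: real assume "e > 0"
      then obtain n where "inverse (real (Suc n)) < e" using reals_Archimedean by blast
      then show "f t \<le> Inf S + e" using elim[rule_format, of n] by (simp add: inverse_eq_divide)
    qed
  qed
  moreover have "Inf S \<ge> 0" using ne by (intro cInf_greatest) (auto simp: S_def)
  moreover have "Inf S \<le> K" if "K \<ge> 0" "AE t in M. f t \<le> K" for K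
    using bd that by (intro cInf_lower) (auto simp: S_def)
  ultimately show thesis using that by blast
qed

lemma initial_size_bounds:
  assumes "initial_functions \<sigma> \<phi> \<psi>"
  shows "s \<le> \<sigma> \<Longrightarrow> \<bar>\<phi> s\<bar> \<le> initial_size \<sigma> \<phi> \<psi>"
    and "s < \<sigma> \<Longrightarrow> \<bar>\<psi> s\<bar> \<le> initial_size \<sigma> \<phi> \<psi>"
proof -
  obtain p q where p: "\<And>s. s \<le> \<sigma> \<Longrightarrow> \<bar>\<phi> s\<bar> \<le> p" and q: "\<And>s. s < \<sigma> \<Longrightarrow> \<bar>\<psi> s\<bar> \<le> q"
    using assms unfolding initial_functions_def bounded_iff by fastforce
  have "bdd_above ((\<lambda>s. \<bar>\<phi> s\<bar> + (if s < \<sigma> then \<bar>\<psi> s\<bar> else 0)) ` {..\<sigma>})"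
  proof (rule bdd_aboveI2)
    fix s assume "s \<in> {..\<sigma>}"
    then show "\<bar>\<phi> s\<bar> + (if s < \<sigma> then \<bar>\<psi> s\<bar> else 0) \<le> p + max q 0"
      using p[of s] q[of s] by auto
  qed
  then have *: "\<bar>\<phi> s\<bar> + (if s < \<sigma> then \<bar>\<psi> s\<bar> else 0) \<le> initial_size \<sigma> \<phi> \<psi>" if "s \<le> \<sigma>" for s
    unfolding initial_size_def using that by (intro cSUP_upper) auto
  show "s \<le> \<sigma> \<Longrightarrow> \<bar>\<phi> s\<bar> \<le> initial_size \<sigma> \<phi> \<psi>" using *[of s] by (auto split: if_splits)
  show "s < \<sigma> \<Longrightarrow> \<bar>\<psi> s\<bar> \<le> initial_size \<sigma> \<phi> \<psi>" using *[of s] by auto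
qed

text \<open>Product rule for increments: on the compact interval \<open>x\<close> is bounded by
  \<open>X\<close>, and the weight is Lipschitz and at most \<open>m\<close>.\<close>

lemma absolutely_continuous_on_exp_mult:
  fixes x :: "real \<Rightarrow> real"
  assumes x: "absolutely_continuous_on {\<sigma>..T} x" and "lam \<ge> 0"
  shows "absolutely_continuous_on {\<sigma>..T} (\<lambda>t. exp (lam * (t - \<sigma>)) * x t)"
proof -
  have "bounded (x ` {\<sigma>..T})"
    by (intro compact_imp_bounded compact_continuous_image absolutely_continuous_on_imp_continuous_on x) auto
  then obtain X where "X > 0" and X: "\<And>s. s \<in> {\<sigma>..T} \<Longrightarrow> \<bar>x s\<bar> \<le> X"
    unfolding bounded_pos by auto
  define m where "m = exp (lam * (T - \<sigma>))"
  have "m > 0" by (simp add: m_def)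
  show ?thesis
  proof (rule absolutely_continuous_on_dominated[OF x, where C = "m * (1 + lam * X)"])
    fix u v assume uv: "u \<in> {\<sigma>..T}" "v \<in> {\<sigma>..T}" "u \<le> v"
    define e where "e s = exp (lam * (s - \<sigma>))" for s
    have ev: "0 < e v" "e v \<le> m" using uv \<open>lam \<ge> 0\<close> by (auto simp: e_def m_def mult_left_mono)
    \<comment> \<open>The growth of the weight is bounded through \<open>1 + q \<le> exp q\<close>
      at \<open>q = - (lam * (v - u))\<close>.\<close>
    have "e u = e v * exp (- (lam * (v - u)))" by (simp add: e_def exp_add[symmetric] algebra_simps)
    also have "\<dots> \<ge> e v * (1 - lam * (v - u))"
      using ev(1) exp_ge_add_one_self[of "- (lam * (v - u))"] by (intro mult_left_mono) auto
    finally have "e v - e u \<le> e v * (lam * (v - u))" by (simp add: algebra_simps)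
    also have "\<dots> \<le> m * (lam * (v - u))" using ev uv \<open>lam \<ge> 0\<close> by (intro mult_right_mono) auto
    finally have 1: "e v - e u \<le> m * (lam * (v - u))" .
    have 2: "0 \<le> e v - e u" using uv \<open>lam \<ge> 0\<close> by (auto simp: e_def mult_left_mono)
    have "\<bar>e v * x v - e u * x u\<bar> = \<bar>e v * (x v - x u) + (e v - e u) * x u\<bar>" by (simp add: algebra_simps)
    also have "\<dots> \<le> e v * \<bar>x v - x u\<bar> + (e v - e u) * \<bar>x u\<bar>"
      using abs_triangle_ineq[of "e v * (x v - x u)" "(e v - e u) * x u"] ev(1) 2 by (simp add: abs_mult)
    also have "\<dots> \<le> m * \<bar>x v - x u\<bar> + m * (lam * (v - u)) * X"
      using X[OF uv(1)] 1 2 ev(2) uv \<open>m > 0\<close> \<open>lam \<ge> 0\<close> by (intro add_mono mult_mono) auto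
    also have "\<dots> \<le> m * (1 + lam * X) * \<bar>x v - x u\<bar> + m * (1 + lam * X) * (v - u)"
      using uv \<open>m > 0\<close> \<open>lam \<ge> 0\<close> \<open>X > 0\<close> by (intro add_mono) (auto simp: algebra_simps)
    finally show "\<bar>exp (lam * (v - \<sigma>)) * x v - exp (lam * (u - \<sigma>)) * x u\<bar> \<le> m * (1 + lam * X) * (\<bar>x v - x u\<bar> + (v - u))"
      by (simp add: e_def algebra_simps)
  qed
qed

text \<open>An almost everywhere bound survives the substitution of \<open>g t\<close> because
  preimages of null sets under \<open>g\<close> are null. Where \<open>g t\<close> falls before
  \<open>\<sigma>\<close>, the weight is at most 1 and the initial derivative is bounded by
  \<open>I\<close>. The sum \<open>V + I\<close> covers both cases and keeps later estimates
  linear.\<close>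

lemma weighted_solution_derivative_delay_bound:
  fixes x \<psi> g :: "real \<Rightarrow> real"
  assumes "\<sigma> \<ge> 0" "lam \<ge> 0" "I \<ge> 0" "V \<ge> 0"
    and V: "AE t in lebesgue. t \<in> {\<sigma>..T} \<longrightarrow> \<bar>exp (lam * (t - \<sigma>)) * deriv x t\<bar> \<le> V"
    and \<psi>: "\<And>s. s < \<sigma> \<Longrightarrow> \<bar>\<psi> s\<bar> \<le> I"
    and g: "\<And>t. t \<ge> \<sigma> \<Longrightarrow> g t \<le> t"
    and null: "\<And>E. E \<in> null_sets lebesgue \<Longrightarrow> {t \<in> {0..}. g t \<in> E} \<in> null_sets lebesgue"
  shows "AE t in lebesgue. t \<in> {\<sigma>..T} \<longrightarrow>
     \<bar>exp (lam * (g t - \<sigma>)) * solution_derivative \<sigma> \<psi> x (g t)\<bar> \<le> V + I"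
proof -
  obtain N where N: "N \<in> null_sets lebesgue"
    and good: "\<And>t. t \<notin> N \<Longrightarrow> t \<in> {\<sigma>..T} \<Longrightarrow> \<bar>exp (lam * (t - \<sigma>)) * deriv x t\<bar> \<le> V"
    using AE_E3[OF V] by (metis DiffI UNIV_I space_completion space_lborel space_borel)
  have "AE t in lebesgue. t \<notin> {t \<in> {0..}. g t \<in> N}" by (rule AE_not_in[OF null[OF N]])
  then show ?thesis
  proof eventually_elim
    case (elim t)
    show ?case
    proof
      assume t: "t \<in> {\<sigma>..T}"
      with elim \<open>\<sigma> \<ge> 0\<close> have "g t \<notin> N" by auto
      have "g t \<le> T" using g[of t] t by auto
      show "\<bar>exp (lam * (g t - \<sigma>)) * solution_derivative \<sigma> \<psi> x (g t)\<bar> \<le> V + I"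
      proof (cases "g t < \<sigma>")
        case True
        then have "exp (lam * (g t - \<sigma>)) \<le> 1" using \<open>lam \<ge> 0\<close> by (simp add: mult_nonneg_nonpos)
        then have "exp (lam * (g t - \<sigma>)) * \<bar>\<psi> (g t)\<bar> \<le> 1 * I"
          using \<psi>[OF True] by (intro mult_mono) auto
        then show ?thesis using True \<open>V \<ge> 0\<close> by (simp add: solution_derivative_def abs_mult)
      next
        case False
        then show ?thesis
          using good[OF \<open>g t \<notin> N\<close>] \<open>g t \<le> T\<close> \<open>I \<ge> 0\<close> by (simp add: solution_derivative_def)
      qed
    qed
  qed
qed

section \<open>Neutral equations\<close>

text \<open>The numbers \<open>p\<close> and \<open>r\<close> bound the change of the weight over
  the delays of \<open>g\<close> and \<open>h\<close>. The equation gives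
  \<open>V \<le> W * Y + C1 * I\<close>, and comparison with the delay equation gives
  \<open>Y \<le> F * Y + C * I\<close>. The four summands of \<open>F\<close> stem from
  differentiating the weight, from the neutral term, from replacing the weighted coefficient by
  \<open>c\<close>, and from moving the delayed argument. No constant depends on
  \<open>\<sigma>\<close>, \<open>T\<close> or the initial functions, which makes the stability
  uniform.\<close>

lemma neutral_solution_weighted_bound:
  fixes a b c g h x \<phi> \<psi> :: "real \<Rightarrow> real"
  assumes sol: "neutral_solution a b g h \<sigma> \<phi> \<psi> x" and init: "initial_functions \<sigma> \<phi> \<psi>"
    and "t0 \<ge> 0" "\<sigma> \<ge> t0"
    and coeff: "AE t in lebesgue. t \<in> {t0..} \<longrightarrow>
      \<bar>a t\<bar> \<le> A \<and> b t \<le> B \<and> c0 \<le> c t \<and> c t \<le> 1 / (\<theta> * exp 1) \<and> c t \<le> b t \<and>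
      \<bar>a t\<bar> \<le> \<alpha> * c t \<and> b t - c t \<le> \<kappa> * c t \<and> t - h t - \<theta> \<le> \<rho>"
    and g: "\<And>t. t \<ge> t0 \<Longrightarrow> g t \<le> t" "\<And>t. t \<ge> t0 \<Longrightarrow> t - g t \<le> \<delta>"
    and h: "\<And>t. t \<ge> t0 \<Longrightarrow> h t \<le> t" "\<And>t. t \<ge> t0 \<Longrightarrow> t - h t \<le> \<tau>"
    and null: "\<And>E. E \<in> null_sets lebesgue \<Longrightarrow> {t \<in> {0..}. g t \<in> E} \<in> null_sets lebesgue"
    and pos: "\<theta> > 0" "c0 > 0" "A \<ge> 0" "B \<ge> 0" "\<alpha> \<ge> 0" "\<kappa> \<ge> 0" "\<rho> \<ge> 0" "lam \<ge> 0"
    and p: "p = exp (lam * \<delta>)" "A * p < 1" and r: "r = exp (lam * \<tau>)" "r \<ge> 1"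
    and W: "W = B * r / (1 - A * p)" and C1: "C1 = (A * p + B * r) / (1 - A * p)"
    and F: "F = lam / c0 + \<alpha> * p * W + (\<kappa> * r + r - 1) + \<rho> * (lam + W)" "F < 1"
    and C: "C = \<alpha> * p * (C1 + 1) + (\<kappa> * r + r - 1) + \<rho> * C1 + 2"
    and "T \<ge> \<sigma>"
  shows "exp (lam * (T - \<sigma>)) * \<bar>x T\<bar> \<le> C / (1 - F) * initial_size \<sigma> \<phi> \<psi>"
proof -

  \<comment> \<open>The weighted solution and its maximum\<close>
  define I where "I = initial_size \<sigma> \<phi> \<psi>"
  note init_le = initial_size_bounds[OF init, folded I_def]
  have I: "I \<ge> 0" using init_le(1)[of \<sigma>] by simp
  define y where "y t = exp (lam * (t - \<sigma>)) * x t" for t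
  define v where "v t = exp (lam * (t - \<sigma>)) * deriv x t" for t
  have x\<phi>: "x t = \<phi> t" if "t \<le> \<sigma>" for t using sol that by (simp add: neutral_solution_def)
  \<comment> \<open>Solutions are described on \<open>{\<sigma>..c}\<close> with
    \<open>c > \<sigma>\<close> only; passing through \<open>T + 1\<close> includes the case
    \<open>T = \<sigma>\<close>. The same is done for the derivative.\<close>
  have "absolutely_continuous_on {\<sigma>..T + 1} x"
    using sol \<open>T \<ge> \<sigma>\<close> by (simp add: neutral_solution_def)
  then have x_ac: "absolutely_continuous_on {\<sigma>..T} x" by (rule absolutely_continuous_on_subset) auto
  have y_ac: "absolutely_continuous_on {\<sigma>..T} y"
    unfolding y_def by (rule absolutely_continuous_on_exp_mult[OF x_ac \<open>lam \<ge> 0\<close>])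
  obtain Y where Y: "\<And>t. t \<in> {\<sigma>..T} \<Longrightarrow> \<bar>y t\<bar> \<le> Y" and Y_attained: "\<exists>t\<in>{\<sigma>..T}. \<bar>y t\<bar> = Y"
  proof -
    have "continuous_on {\<sigma>..T} (\<lambda>t. \<bar>y t\<bar>)"
      by (intro continuous_intros absolutely_continuous_on_imp_continuous_on y_ac)
    then obtain m where "m \<in> {\<sigma>..T}" "\<forall>t\<in>{\<sigma>..T}. \<bar>y t\<bar> \<le> \<bar>y m\<bar>"
      using continuous_attains_sup[of "{\<sigma>..T}" "\<lambda>t. \<bar>y t\<bar>"] \<open>T \<ge> \<sigma>\<close> by auto
    then show thesis by (intro that[of "\<bar>y m\<bar>"]) auto
  qed
  have Y0: "Y \<ge> 0" using Y_attained by auto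
  have y_le: "\<bar>y s\<bar> \<le> I" if "s \<le> \<sigma>" for s
  proof -
    have "exp (lam * (s - \<sigma>)) * \<bar>\<phi> s\<bar> \<le> 1 * I"
      using init_le(1)[OF that] that \<open>lam \<ge> 0\<close> by (intro mult_mono) (auto simp: mult_nonneg_nonpos)
    then show ?thesis by (simp add: y_def x\<phi>[OF that] abs_mult)
  qed
  have y_le2: "\<bar>y s\<bar> \<le> Y + I" if "s \<le> T" for s
    using y_le[of s] Y[of s] that I Y0 by (cases "s \<le> \<sigma>") auto

  have diff: "AE t in lebesgue. t \<in> {\<sigma>..T} \<longrightarrow> x differentiable (at t)"
    using sol unfolding neutral_solution_def AE_lebesgue_on_interval_iff
    by (auto elim!: eventually_mono)
  have y_deriv: "AE t in lebesgue. t \<in> {\<sigma>..T} \<longrightarrow> (y has_real_derivative (lam * y t + v t)) (at t)"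
    using diff
  proof eventually_elim
    case (elim t)
    show ?case
    proof
      assume "t \<in> {\<sigma>..T}"
      with elim have "(x has_real_derivative deriv x t) (at t)"
        using DERIV_deriv_iff_real_differentiable by blast
      then show "(y has_real_derivative (lam * y t + v t)) (at t)"
        unfolding y_def[abs_def] v_def by (auto intro!: derivative_eq_intros simp: algebra_simps)
    qed
  qed

  \<comment> \<open>The weighted derivative\<close>
  obtain V where V0: "V \<ge> 0" and V: "AE t in lebesgue. t \<in> {\<sigma>..T} \<longrightarrow> \<bar>v t\<bar> \<le> V"
    and V_least: "\<And>K. K \<ge> 0 \<Longrightarrow> AE t in lebesgue. t \<in> {\<sigma>..T} \<longrightarrow> \<bar>v t\<bar> \<le> K \<Longrightarrow> V \<le> K"
  proof -
    have "essentially_bounded_on {\<sigma>..T + 1} (deriv x)"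
      using sol \<open>T \<ge> \<sigma>\<close> by (simp add: neutral_solution_def)
    then obtain K where "AE t in lebesgue. t \<in> {\<sigma>..T + 1} \<longrightarrow> \<bar>deriv x t\<bar> \<le> K"
      by (auto simp: essentially_bounded_on_def AE_lebesgue_on_interval_iff)
    then have "AE t in lebesgue_on {\<sigma>..T}. \<bar>v t\<bar> \<le> exp (lam * (T - \<sigma>)) * K"
      unfolding AE_lebesgue_on_interval_iff
    proof eventually_elim
      case (elim t)
      then show ?case using \<open>lam \<ge> 0\<close> by (auto simp: v_def abs_mult intro!: mult_mono mult_left_mono)
    qed
    then obtain V where "V \<ge> 0" "AE t in lebesgue_on {\<sigma>..T}. \<bar>v t\<bar> \<le> V"
      "\<And>K. K \<ge> 0 \<Longrightarrow> AE t in lebesgue_on {\<sigma>..T}. \<bar>v t\<bar> \<le> K \<Longrightarrow> V \<le> K"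
      by (rule least_essential_bound) blast
    then show thesis by (intro that[of V]) (simp_all only: AE_lebesgue_on_interval_iff)
  qed

  have sd: "AE t in lebesgue. t \<in> {\<sigma>..T} \<longrightarrow>
     \<bar>exp (lam * (g t - \<sigma>)) * solution_derivative \<sigma> \<psi> x (g t)\<bar> \<le> V + I"
    using \<open>t0 \<ge> 0\<close> \<open>\<sigma> \<ge> t0\<close> \<open>lam \<ge> 0\<close> I V0 V init_le(2) g(1) null
    by (intro weighted_solution_derivative_delay_bound) (auto simp: v_def)

  have eq: "AE t in lebesgue. t \<in> {\<sigma>..} \<longrightarrow> deriv x t - a t * solution_derivative \<sigma> \<psi> x (g t) + b t * x (h t) = 0"
    using sol unfolding neutral_solution_def AE_lebesgue_on_interval_iff
    by blast

  define S where "S t = exp (lam * (t - \<sigma>)) * solution_derivative \<sigma> \<psi> x (g t)" for t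
  define E where "E t = exp (lam * (t - h t))" for t
  \<comment> \<open>The equation is multiplied by the weight at \<open>t\<close>, while
    \<open>y\<close> carries the weight at \<open>h t\<close> and the bound \<open>V + I\<close>
    refers to the weight at \<open>g t\<close>. The adjustment costs the factors \<open>E t\<close>
    and \<open>exp (lam * (t - g t)) \<le> p\<close>.\<close>
  have v_eq: "AE t in lebesgue. t \<in> {\<sigma>..T} \<longrightarrow> v t = a t * S t - b t * E t * y (h t) \<and> \<bar>S t\<bar> \<le> p * (V + I)"
    using eq sd
  proof eventually_elim
    case (elim t)
    show ?case
    proof
      assume t: "t \<in> {\<sigma>..T}"
      with elim(1) have dx: "deriv x t = a t * solution_derivative \<sigma> \<psi> x (g t) - b t * x (h t)" by auto
      have ew: "E t * exp (lam * (h t - \<sigma>)) = exp (lam * (t - \<sigma>))"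
        by (simp add: E_def exp_add[symmetric] algebra_simps)
      have "b t * E t * y (h t) = b t * (E t * exp (lam * (h t - \<sigma>))) * x (h t)" by (simp add: y_def)
      also have "\<dots> = exp (lam * (t - \<sigma>)) * (b t * x (h t))" unfolding ew by (simp only: mult.assoc mult.left_commute)
      finally have bE: "b t * E t * y (h t) = exp (lam * (t - \<sigma>)) * (b t * x (h t))" .
      have aS: "a t * S t = exp (lam * (t - \<sigma>)) * (a t * solution_derivative \<sigma> \<psi> x (g t))"
        by (simp add: S_def)
      have vS: "v t = a t * S t - b t * E t * y (h t)"
        unfolding v_def dx aS bE by (rule right_diff_distrib)
      have "exp (lam * (t - g t)) * exp (lam * (g t - \<sigma>)) = exp (lam * (t - \<sigma>))"
        by (simp add: exp_add[symmetric] algebra_simps)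
      then have "S t = exp (lam * (t - g t)) * (exp (lam * (g t - \<sigma>)) * solution_derivative \<sigma> \<psi> x (g t))"
        by (simp add: S_def mult.assoc[symmetric])
      then have "\<bar>S t\<bar> = exp (lam * (t - g t)) * \<bar>exp (lam * (g t - \<sigma>)) * solution_derivative \<sigma> \<psi> x (g t)\<bar>"
        by (simp add: abs_mult)
      also have "\<dots> \<le> p * (V + I)"
        using elim(2) t g(2)[of t] \<open>\<sigma> \<ge> t0\<close> \<open>lam \<ge> 0\<close> unfolding p
        by (intro mult_mono) (auto simp: mult_left_mono)
      finally show "v t = a t * S t - b t * E t * y (h t) \<and> \<bar>S t\<bar> \<le> p * (V + I)" using vS by blast
    qed
  qed

  have E: "1 \<le> E t" "E t \<le> r" if "t \<in> {\<sigma>..T}" for t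
    using h[of t] that \<open>\<sigma> \<ge> t0\<close> \<open>lam \<ge> 0\<close> by (auto simp: E_def r mult_left_mono)
  have p0: "p > 0" by (simp add: p)
  have V_le: "V \<le> W * Y + C1 * I"
  proof -
    \<comment> \<open>The bound for the derivative contains \<open>V\<close> again; minimality of
      \<open>V\<close> turns it into an inequality for \<open>V\<close> itself, which
      \<open>A * p < 1\<close> allows to be solved.\<close>
    have "V \<le> A * (p * (V + I)) + B * r * (Y + I)"
    proof (rule V_least)
      show "0 \<le> A * (p * (V + I)) + B * r * (Y + I)" using pos p0 r V0 I Y0 by simp
      show "AE t in lebesgue. t \<in> {\<sigma>..T} \<longrightarrow> \<bar>v t\<bar> \<le> A * (p * (V + I)) + B * r * (Y + I)"
        using v_eq coeff
      proof eventually_elim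
        case (elim t)
        show ?case
        proof
          assume t: "t \<in> {\<sigma>..T}"
          then have "t \<in> {t0..}" using \<open>\<sigma> \<ge> t0\<close> by auto
          with elim have c: "\<bar>a t\<bar> \<le> A" "b t \<le> B" "c0 \<le> c t" "c t \<le> b t" by auto
          have S: "v t = a t * S t - b t * E t * y (h t)" "\<bar>S t\<bar> \<le> p * (V + I)" using elim t by auto
          have b: "b t \<ge> 0" using c pos by linarith
          have yh: "\<bar>y (h t)\<bar> \<le> Y + I" using h(1)[of t] t \<open>\<sigma> \<ge> t0\<close> by (intro y_le2) auto
          have "\<bar>v t\<bar> \<le> \<bar>a t\<bar> * \<bar>S t\<bar> + b t * E t * \<bar>y (h t)\<bar>"
            using abs_triangle_ineq4[of "a t * S t" "b t * E t * y (h t)"] b E(1)[OF t]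
            by (simp add: S(1) abs_mult)
          also have "\<dots> \<le> A * (p * (V + I)) + B * r * (Y + I)"
            using c S(2) b E[OF t] yh pos p0 V0 I Y0 by (intro add_mono mult_mono) auto
          finally show "\<bar>v t\<bar> \<le> A * (p * (V + I)) + B * r * (Y + I)" .
        qed
      qed
    qed
    then have "V * (1 - A * p) \<le> B * r * Y + (A * p + B * r) * I" by (simp add: algebra_simps)
    then have "V \<le> (B * r * Y + (A * p + B * r) * I) / (1 - A * p)"
      using p(2) by (simp add: pos_le_divide_eq)
    then show ?thesis unfolding W C1 by (simp only: times_divide_eq_left add_divide_distrib[symmetric])
  qed

  \<comment> \<open>Comparison with the scalar delay equation\<close>
  have y_lip: "\<bar>y w - y u\<bar> \<le> (lam * Y + V) * (w - u)" if "\<sigma> \<le> u" "u \<le> w" "w \<le> T" for u w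
  proof (rule lipschitz_if_AE_deriv_bounded[OF y_ac _ that])
    show "AE t in lebesgue. t \<in> {\<sigma>..T} \<longrightarrow> (\<exists>d. \<bar>d\<bar> \<le> lam * Y + V \<and> (y has_real_derivative d) (at t))"
      using y_deriv V
    proof eventually_elim
      case (elim t)
      show ?case
      proof
        assume t: "t \<in> {\<sigma>..T}"
        have "\<bar>lam * y t + v t\<bar> \<le> lam * \<bar>y t\<bar> + \<bar>v t\<bar>"
          using abs_triangle_ineq[of "lam * y t" "v t"] \<open>lam \<ge> 0\<close> by (simp add: abs_mult)
        also have "\<dots> \<le> lam * Y + V"
          using Y[OF t] elim t \<open>lam \<ge> 0\<close> by (intro add_mono mult_left_mono) auto
        finally show "\<exists>d. \<bar>d\<bar> \<le> lam * Y + V \<and> (y has_real_derivative d) (at t)" using elim t by blast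
      qed
    qed
  qed

  \<comment> \<open>The maximum with \<open>\<sigma>\<close> replaces the prehistory of \<open>y\<close> by the constant \<open>y \<sigma>\<close>, at a cost of at most \<open>2 * I\<close>.\<close>
  define H where "H t = max (max (h t) (t - \<theta>)) \<sigma>" for t
  have yH: "\<bar>y (H t) - y (h t)\<bar> \<le> \<rho> * (lam * Y + V) + 2 * I"
    if t: "t \<in> {\<sigma>..T}" and \<rho>: "t - h t - \<theta> \<le> \<rho>" for t
  proof -
    have HT: "H t \<le> T" using t h(1)[of t] pos \<open>\<sigma> \<ge> t0\<close> by (auto simp: H_def)
    have L0: "0 \<le> lam * Y + V" using pos Y0 V0 by simp
    \<comment> \<open>The prehistory is separated from the shift: \<open>H t\<close> exceeds
      \<open>u\<close> only if \<open>h t < t - \<theta>\<close>, and then by at most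
      \<open>t - h t - \<theta>\<close>.\<close>
    define u where "u = max (h t) \<sigma>"
    have u: "\<sigma> \<le> u" "u \<le> H t" "H t - u \<le> \<rho>" using \<rho> \<open>\<rho> \<ge> 0\<close> by (auto simp: u_def H_def)
    have "\<bar>y (H t) - y u\<bar> \<le> (lam * Y + V) * (H t - u)" by (rule y_lip[OF u(1,2) HT])
    also have "\<dots> \<le> (lam * Y + V) * \<rho>" using u(3) L0 by (rule mult_left_mono)
    finally have 1: "\<bar>y (H t) - y u\<bar> \<le> \<rho> * (lam * Y + V)" by (simp add: mult.commute)
    have 2: "\<bar>y u - y (h t)\<bar> \<le> 2 * I"
      using y_le[of \<sigma>] y_le[of "h t"] I by (cases "h t \<le> \<sigma>") (auto simp: u_def max_def)
    show ?thesis using 1 2 by linarith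
  qed

  have p_nonneg: "W \<ge> 0" "C1 \<ge> 0" using pos p0 p(2) r by (auto simp: W C1)
  have "lam / c0 \<ge> 0" "\<alpha> * p * W \<ge> 0" "\<kappa> * r \<ge> 0" "\<rho> * (lam + W) \<ge> 0"
    using pos p0 r p_nonneg by auto
  then have F0: "F \<ge> 0" using r(2) unfolding F(1) by linarith
  have "\<alpha> * p * (C1 + 1) \<ge> 0" "\<kappa> * r \<ge> 0" "\<rho> * C1 \<ge> 0"
    using pos p0 r p_nonneg by auto
  then have C2: "C \<ge> 2" using r(2) unfolding C by linarith
  have "\<bar>y t\<bar> \<le> F * Y + C * I" if "t \<in> {\<sigma>..T}" for t
  proof (rule delay_equation_bound[OF y_ac \<open>\<theta> > 0\<close> _ _ that, where H = H and c = c])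
    have "1 * I \<le> C * I" using C2 I by (intro mult_right_mono) auto
    moreover have "F * Y \<ge> 0" using F0 Y0 by simp
    ultimately show "\<bar>y \<sigma>\<bar> \<le> F * Y + C * I" using y_le[of \<sigma>] by simp
    show "AE t in lebesgue. t \<in> {\<sigma>..T} \<longrightarrow>
      \<sigma> \<le> H t \<and> H t \<le> t \<and> t - H t \<le> \<theta> \<and> 0 \<le> c t \<and> c t \<le> 1 / (\<theta> * exp 1) \<and>
      (\<exists>d. (y has_real_derivative d) (at t) \<and> \<bar>d + c t * y (H t)\<bar> \<le> c t * (F * Y + C * I))"
      using coeff y_deriv v_eq
    proof eventually_elim
      case (elim t)
      show ?case
      proof
        assume t: "t \<in> {\<sigma>..T}"
        then have t': "t \<in> {t0..}" using \<open>\<sigma> \<ge> t0\<close> by auto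
        with elim have c: "c0 \<le> c t" "c t \<le> 1 / (\<theta> * exp 1)" "c t \<le> b t"
          "\<bar>a t\<bar> \<le> \<alpha> * c t" "b t - c t \<le> \<kappa> * c t" "t - h t - \<theta> \<le> \<rho>" by auto
        have c_pos: "c t > 0" using c(1) pos by linarith
        have S: "v t = a t * S t - b t * E t * y (h t)" "\<bar>S t\<bar> \<le> p * (V + I)" using elim t by auto
        have hT: "h t \<le> T" using h(1)[of t] t t' by auto
        \<comment> \<open>Each of the four error terms must carry the factor \<open>c t\<close> to
          fit \<open>delay_equation_bound\<close> with \<open>K = F * Y + C * I\<close>. For this
          first one the factor comes from \<open>c0 \<le> c t\<close>.\<close>
        have 1: "\<bar>lam * y t\<bar> \<le> c t * (lam / c0 * Y)"
        proof -
          have "\<bar>lam * y t\<bar> \<le> lam * Y" using Y[OF t] \<open>lam \<ge> 0\<close> by (simp add: abs_mult mult_left_mono)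
          also have "\<dots> = c0 * (lam / c0 * Y)" using pos by simp
          also have "\<dots> \<le> c t * (lam / c0 * Y)" using c(1) pos Y0 by (intro mult_right_mono) auto
          finally show ?thesis .
        qed
        have 2: "\<bar>a t * S t\<bar> \<le> c t * (\<alpha> * (p * (V + I)))"
        proof -
          have "\<bar>a t * S t\<bar> \<le> \<alpha> * c t * (p * (V + I))"
            unfolding abs_mult using c(4) S(2) pos c_pos by (intro mult_mono) auto
          then show ?thesis by (simp add: algebra_simps)
        qed
        have 3: "\<bar>(b t * E t - c t) * y (h t)\<bar> \<le> c t * ((\<kappa> * r + r - 1) * (Y + I))"
        proof -
          have "b t * 1 \<le> b t * E t" using E(1)[OF t] c(3) c_pos by (intro mult_left_mono) auto
          then have lower: "0 \<le> b t * E t - c t" using c(3) by linarith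
          \<comment> \<open>Here \<open>b t * r - c t = (b t - c t) * r + c t * (r - 1)\<close>, and
            the first summand is at most \<open>\<kappa> * c t * r\<close>.\<close>
          have "b t * E t \<le> b t * r" using E(2)[OF t] c(3) c_pos by (intro mult_left_mono) auto
          moreover have "(b t - c t) * r \<le> \<kappa> * c t * r" using c(5) r(2) by (intro mult_right_mono) auto
          ultimately have "b t * E t - c t \<le> c t * (\<kappa> * r + r - 1)" by (simp add: algebra_simps)
          then have "(b t * E t - c t) * \<bar>y (h t)\<bar> \<le> c t * (\<kappa> * r + r - 1) * (Y + I)"
            using lower y_le2[OF hT] by (intro mult_mono) auto
          then show ?thesis using lower by (simp add: abs_mult mult.assoc)
        qed
        have 4: "\<bar>c t * (y (H t) - y (h t))\<bar> \<le> c t * (\<rho> * (lam * Y + V) + 2 * I)"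
          using yH[OF t c(6)] c_pos by (simp add: abs_mult)
        have "\<bar>lam * y t + v t + c t * y (H t)\<bar>
            = \<bar>lam * y t + a t * S t - (b t * E t - c t) * y (h t) + c t * (y (H t) - y (h t))\<bar>"
          by (simp add: S(1) algebra_simps)
        also have "\<dots> \<le> c t * (lam / c0 * Y) + c t * (\<alpha> * (p * (V + I)))
            + c t * ((\<kappa> * r + r - 1) * (Y + I)) + c t * (\<rho> * (lam * Y + V) + 2 * I)"
          using 1 2 3 4 by linarith
        also have "\<dots> = c t * (lam / c0 * Y + \<alpha> * p * (V + I)
            + (\<kappa> * r + r - 1) * (Y + I) + \<rho> * (lam * Y + V) + 2 * I)"
          by (simp add: algebra_simps)
        also have "\<dots> \<le> c t * (F * Y + C * I)"
        proof (intro mult_left_mono)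
          have "\<alpha> * p * (V + I) \<le> \<alpha> * p * (W * Y + C1 * I + I)"
            using V_le pos p0 by (intro mult_left_mono) auto
          moreover have "\<rho> * (lam * Y + V) \<le> \<rho> * (lam * Y + (W * Y + C1 * I))"
            using V_le pos by (intro mult_left_mono) auto
          moreover have "F * Y + C * I = lam / c0 * Y + \<alpha> * p * (W * Y + C1 * I + I)
            + (\<kappa> * r + r - 1) * (Y + I) + \<rho> * (lam * Y + (W * Y + C1 * I)) + 2 * I"
            unfolding F(1) C by (simp add: algebra_simps)
          ultimately show "lam / c0 * Y + \<alpha> * p * (V + I) + (\<kappa> * r + r - 1) * (Y + I)
            + \<rho> * (lam * Y + V) + 2 * I \<le> F * Y + C * I" by linarith
        qed (use c_pos in simp)
        finally have "\<bar>lam * y t + v t + c t * y (H t)\<bar> \<le> c t * (F * Y + C * I)" .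
        moreover have "\<sigma> \<le> H t" "H t \<le> t" "t - H t \<le> \<theta>"
          using t t' h(1)[of t] pos by (auto simp: H_def)
        ultimately show "\<sigma> \<le> H t \<and> H t \<le> t \<and> t - H t \<le> \<theta> \<and> 0 \<le> c t \<and> c t \<le> 1 / (\<theta> * exp 1) \<and>
           (\<exists>d. (y has_real_derivative d) (at t) \<and> \<bar>d + c t * y (H t)\<bar> \<le> c t * (F * Y + C * I))"
          using c_pos c(2) elim(2) t by auto
      qed
    qed
  qed
  \<comment> \<open>The pointwise bound is used where the maximum is attained; \<open>F < 1\<close>
    then absorbs \<open>F * Y\<close>.\<close>
  then have "Y \<le> F * Y + C * I" using Y_attained by force
  then have "Y \<le> C * I / (1 - F)" using F(2) by (simp add: pos_le_divide_eq algebra_simps)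
  moreover have "exp (lam * (T - \<sigma>)) * \<bar>x T\<bar> \<le> Y"
    using Y[of T] \<open>T \<ge> \<sigma>\<close> by (simp add: y_def abs_mult)
  ultimately show ?thesis by (simp add: I_def)
qed

text \<open>As the rate tends to 0 from above, \<open>F\<close> tends to the left-hand side of the
  smallness condition. Hence some positive \<open>lam\<close> has both \<open>F lam < 1\<close> and
  \<open>A * exp (lam * \<delta>) < 1\<close>, and it is the decay rate, with factor
  \<open>C / (1 - F lam)\<close>.\<close>

lemma neutral_exponentially_stableI:
  fixes a b c g h :: "real \<Rightarrow> real"
  assumes "t0 \<ge> 0"
    and coeff: "AE t in lebesgue. t \<in> {t0..} \<longrightarrow>
      \<bar>a t\<bar> \<le> A \<and> b t \<le> B \<and> c0 \<le> c t \<and> c t \<le> 1 / (\<theta> * exp 1) \<and> c t \<le> b t \<and>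
      \<bar>a t\<bar> \<le> \<alpha> * c t \<and> b t - c t \<le> \<kappa> * c t \<and> t - h t - \<theta> \<le> \<rho>"
    and g: "\<And>t. t \<ge> t0 \<Longrightarrow> g t \<le> t" "\<And>t. t \<ge> t0 \<Longrightarrow> t - g t \<le> \<delta>"
    and h: "\<And>t. t \<ge> t0 \<Longrightarrow> h t \<le> t" "\<And>t. t \<ge> t0 \<Longrightarrow> t - h t \<le> \<tau>"
    and null: "\<And>E. E \<in> null_sets lebesgue \<Longrightarrow> {t \<in> {0..}. g t \<in> E} \<in> null_sets lebesgue"
    and pos: "\<theta> > 0" "c0 > 0" "A \<ge> 0" "B \<ge> 0" "\<alpha> \<ge> 0" "\<kappa> \<ge> 0" "\<rho> \<ge> 0" "\<tau> \<ge> 0"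
    and "A < 1" and small: "(\<alpha> + \<rho>) * B / (1 - A) + \<kappa> < 1"
  shows "neutral_exponentially_stable t0 a b g h"
proof -
  define W where "W l = B * exp (l * \<tau>) / (1 - A * exp (l * \<delta>))" for l
  define F where "F l = l / c0 + \<alpha> * exp (l * \<delta>) * W l + (\<kappa> * exp (l * \<tau>) + exp (l * \<tau>) - 1) + \<rho> * (l + W l)" for l
  have "((\<lambda>l. A * exp (l * \<delta>)) \<longlongrightarrow> A) (at_right 0)" by (auto intro!: tendsto_eq_intros)
  then have ev1: "\<forall>\<^sub>F l in at_right 0. A * exp (l * \<delta>) < 1"
    using \<open>A < 1\<close> by (rule order_tendstoD)
  have W: "(W \<longlongrightarrow> B / (1 - A)) (at_right 0)"
    unfolding W_def using \<open>A < 1\<close> by (auto intro!: tendsto_eq_intros)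
  \<comment> \<open>At rate 0 both exponential factors are 1, so the third summand reduces to
    \<open>\<kappa>\<close>; the first one vanishes because \<open>c0 > 0\<close> is fixed.\<close>
  have "(F \<longlongrightarrow> 0 / c0 + \<alpha> * exp (0 * \<delta>) * (B / (1 - A)) + (\<kappa> * exp (0 * \<tau>) + exp (0 * \<tau>) - 1) + \<rho> * (0 + B / (1 - A))) (at_right 0)"
    unfolding F_def using pos by (intro tendsto_intros W) auto
  then have "(F \<longlongrightarrow> (\<alpha> + \<rho>) * B / (1 - A) + \<kappa>) (at_right 0)"
    by (simp add: algebra_simps add_divide_distrib)
  then have "\<forall>\<^sub>F l in at_right 0. F l < 1" using small by (rule order_tendstoD)
  then have "\<forall>\<^sub>F l in at_right 0. F l < 1 \<and> A * exp (l * \<delta>) < 1 \<and> 0 < l"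
    using ev1 eventually_at_right_less[of "0::real"] by eventually_elim auto
  then obtain lam where lam: "F lam < 1" "A * exp (lam * \<delta>) < 1" "0 < lam"
    using eventually_happens[of _ "at_right (0::real)"] by fastforce
  define p r where "p = exp (lam * \<delta>)" and "r = exp (lam * \<tau>)"
  define C1 where "C1 = (A * p + B * r) / (1 - A * p)"
  define C where "C = \<alpha> * p * (C1 + 1) + (\<kappa> * r + r - 1) + \<rho> * C1 + 2"
  have r: "r \<ge> 1" using lam pos by (simp add: r_def)
  have p: "p > 0" "A * p < 1" using lam by (simp_all add: p_def)
  have W_eq: "W lam = B * r / (1 - A * p)" by (simp add: W_def p_def r_def)
  have F_eq: "F lam = lam / c0 + \<alpha> * p * W lam + (\<kappa> * r + r - 1) + \<rho> * (lam + W lam)"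
    by (simp add: F_def p_def r_def)
  have C1: "C1 \<ge> 0" using pos p r by (simp add: C1_def)
  have "\<alpha> * p * (C1 + 1) \<ge> 0" "\<kappa> * r \<ge> 0" "\<rho> * C1 \<ge> 0"
    using pos p r C1 by auto
  then have "C > 0" using r unfolding C_def by linarith
  have "\<bar>x t\<bar> \<le> C / (1 - F lam) * exp (- lam * (t - \<sigma>)) * initial_size \<sigma> \<phi> \<psi>"
    if "\<sigma> \<ge> t0" "initial_functions \<sigma> \<phi> \<psi>" "neutral_solution a b g h \<sigma> \<phi> \<psi> x" "t \<ge> \<sigma>" for \<sigma> \<phi> \<psi> x t
  proof -
    have "exp (lam * (t - \<sigma>)) * \<bar>x t\<bar> \<le> C / (1 - F lam) * initial_size \<sigma> \<phi> \<psi>"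
      by (rule neutral_solution_weighted_bound[OF that(3,2) \<open>t0 \<ge> 0\<close> that(1) coeff _ _ _ _ _ pos(1-7)
            less_imp_le[OF lam(3)] p_def p(2) r_def r W_eq C1_def F_eq lam(1) C_def that(4)]) (erule g h null)+
    then have "exp (- lam * (t - \<sigma>)) * (exp (lam * (t - \<sigma>)) * \<bar>x t\<bar>)
        \<le> exp (- lam * (t - \<sigma>)) * (C / (1 - F lam) * initial_size \<sigma> \<phi> \<psi>)"
      by (rule mult_left_mono) simp
    also have "exp (- lam * (t - \<sigma>)) * (exp (lam * (t - \<sigma>)) * \<bar>x t\<bar>) = \<bar>x t\<bar>"
      by (simp add: mult.assoc[symmetric] exp_add[symmetric])
    finally show ?thesis by (simp only: mult_ac)
  qed
  moreover have "C / (1 - F lam) > 0" using \<open>C > 0\<close> lam by simp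
  ultimately show ?thesis unfolding neutral_exponentially_stable_def using lam(3) by blast
qed

text \<open>The bound \<open>K\<close> keeps the extended essential supremum finite from above, and
  the half-line having nonzero measure keeps it at least 0. The conversion to a real number is
  therefore faithful.\<close>

lemma ess_norm_properties:
  assumes f: "f \<in> borel_measurable (lebesgue_on {t0..})"
    and K: "AE t in lebesgue. t \<in> {t0..} \<longrightarrow> \<bar>f t\<bar> \<le> K"
  shows AE_le_ess_norm: "AE t in lebesgue. t \<in> {t0..} \<longrightarrow> \<bar>f t\<bar> \<le> ess_norm t0 f"
    and ess_norm_ge: "(\<And>t. t \<ge> t0 \<Longrightarrow> l \<le> \<bar>f t\<bar>) \<Longrightarrow> l \<le> ess_norm t0 f"
    and ess_norm_nonneg: "0 \<le> ess_norm t0 f"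
proof -
  let ?M = "lebesgue_on {t0..}"
  define s where "s = esssup ?M (\<lambda>t. ereal \<bar>f t\<bar>)"
  have meas: "(\<lambda>t. ereal \<bar>f t\<bar>) \<in> borel_measurable ?M" using f by measurable
  have "{t0..t0 + 1} \<subseteq> {t0..}" by auto
  then have "emeasure lebesgue {t0..t0 + 1} \<le> emeasure lebesgue {t0..}"
    by (rule emeasure_mono) simp
  then have "emeasure ?M (space ?M) \<noteq> 0"
    by (auto simp: emeasure_restrict_space space_restrict_space)
  then have const: "esssup ?M (\<lambda>_. ereal l) = ereal l" for l by (rule esssup_const)
  have lower: "ereal l \<le> s" if "\<And>t. t \<ge> t0 \<Longrightarrow> l \<le> \<bar>f t\<bar>" for l
  proof -
    have "esssup ?M (\<lambda>_. ereal l) \<le> s"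
      unfolding s_def using that by (intro esssup_AE_mono AE_I2) (auto simp: space_restrict_space)
    then show ?thesis by (simp only: const)
  qed
  have "s \<le> ereal K"
    unfolding s_def using K by (intro esssup_I meas) (simp add: AE_lebesgue_on_interval_iff)
  moreover have "ereal 0 \<le> s" by (rule lower) simp
  ultimately have s: "ereal (ess_norm t0 f) = s"
    unfolding ess_norm_def s_def[symmetric] by (cases s) auto
  have "AE t in ?M. ereal \<bar>f t\<bar> \<le> s" unfolding s_def by (rule esssup_AE)
  then show "AE t in lebesgue. t \<in> {t0..} \<longrightarrow> \<bar>f t\<bar> \<le> ess_norm t0 f"
    unfolding s[symmetric] by (simp add: AE_lebesgue_on_interval_iff)
  show "l \<le> ess_norm t0 f" if "\<And>t. t \<ge> t0 \<Longrightarrow> l \<le> \<bar>f t\<bar>"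
    using lower[OF that] unfolding s[symmetric] by simp
  show "0 \<le> ess_norm t0 f" using \<open>ereal 0 \<le> s\<close> unfolding s[symmetric] by simp
qed

theorem theorem4p4:
  fixes t0 a0 \<beta> \<delta> \<tau> :: real
    and a b g h :: "real \<Rightarrow> real"
  assumes "t0 \<ge> 0"
    and "a \<in> borel_measurable (lebesgue_on {0..})"
    and "b \<in> borel_measurable (lebesgue_on {0..})"
    and "g \<in> borel_measurable (lebesgue_on {0..})"
    and "h \<in> borel_measurable (lebesgue_on {0..})"
    and "essentially_bounded_on {0..} a"
    and "essentially_bounded_on {0..} b"
    and "ess_norm t0 a \<le> a0" and "a0 < 1"
    and "\<And>t. t \<ge> 0 \<Longrightarrow> b t \<ge> 0"
    and "\<And>t. t \<ge> 0 \<Longrightarrow> g t \<le> t"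
    and "\<And>t. t \<ge> 0 \<Longrightarrow> h t \<le> t"
    and "filterlim g at_top at_top"
    and "filterlim h at_top at_top"
    and "\<And>E. E \<in> null_sets lebesgue \<Longrightarrow> {t \<in> {0..}. g t \<in> E} \<in> null_sets lebesgue"
    and "\<delta> > 0" and "\<And>t. t \<ge> t0 \<Longrightarrow> t - g t \<le> \<delta>"
    and "\<tau> > 0" and "\<And>t. t \<ge> t0 \<Longrightarrow> t - h t \<le> \<tau>"
    and "\<beta> > 0" and "\<And>t. t \<ge> t0 \<Longrightarrow> b t \<ge> \<beta>"
    and "(let b0 = (\<lambda>t. min (b t) (1 / (\<tau> * exp 1))) in
            ess_norm t0 (\<lambda>t. a t / b0 t) * (ess_norm t0 b / (1 - ess_norm t0 a))
              + ess_norm t0 (\<lambda>t. (b t - b0 t) / b0 t) < 1)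
         \<or> ess_norm t0 b *
            (ess_norm t0 (\<lambda>t. a t / b t)
              + ess_norm t0 (\<lambda>t. max (t - h t - 1 / (ess_norm t0 b * exp 1)) 0))
            < 1 - ess_norm t0 a"
  shows "neutral_exponentially_stable t0 a b g h"
proof -
  note \<tau> = \<open>\<tau> > 0\<close> and \<beta> = \<open>\<beta> > 0\<close> and b_ge = assms(21)
  have sub: "{t0..} \<subseteq> {0..}" using \<open>t0 \<ge> 0\<close> by auto
  have meas[measurable]: "a \<in> borel_measurable (lebesgue_on {t0..})" "b \<in> borel_measurable (lebesgue_on {t0..})"
    "h \<in> borel_measurable (lebesgue_on {t0..})"
    using assms(2,3,5) by (auto intro: measurable_restrict_mono[OF _ sub])
  obtain Ka Kb where K: "AE t in lebesgue. t \<in> {0..} \<longrightarrow> \<bar>a t\<bar> \<le> Ka" "AE t in lebesgue. t \<in> {0..} \<longrightarrow> \<bar>b t\<bar> \<le> Kb"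
    using assms(6,7) by (auto simp: essentially_bounded_on_def AE_lebesgue_on_interval_iff)
  have Ka: "AE t in lebesgue. t \<in> {t0..} \<longrightarrow> \<bar>a t\<bar> \<le> Ka" and Kb: "AE t in lebesgue. t \<in> {t0..} \<longrightarrow> \<bar>b t\<bar> \<le> Kb"
    using K sub by - (erule eventually_mono; force)+
  define A B where "A = ess_norm t0 a" and "B = ess_norm t0 b"
  have A: "0 \<le> A" "A < 1" "AE t in lebesgue. t \<in> {t0..} \<longrightarrow> \<bar>a t\<bar> \<le> A"
    using ess_norm_nonneg[OF meas(1) Ka] AE_le_ess_norm[OF meas(1) Ka] assms(8,9) by (auto simp: A_def)
  have B: "AE t in lebesgue. t \<in> {t0..} \<longrightarrow> \<bar>b t\<bar> \<le> B"
    using AE_le_ess_norm[OF meas(2) Kb] by (simp add: B_def)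
  \<comment> \<open>This makes \<open>B\<close> positive, as needed for the division in
    \<open>1 / (B * exp 1)\<close>.\<close>
  have "\<beta> \<le> B" unfolding B_def
    by (rule ess_norm_ge[OF meas(2) Kb]) (use b_ge in \<open>fastforce intro: order_trans[OF _ abs_ge_self]\<close>)
  with \<beta> have B0: "B > 0" by simp
  have g_le: "\<And>t. t \<ge> t0 \<Longrightarrow> g t \<le> t" and h_le: "\<And>t. t \<ge> t0 \<Longrightarrow> h t \<le> t"
    using assms(11,12) \<open>t0 \<ge> 0\<close> by auto
  \<comment> \<open>Supplies the finite essential bounds on quotients without which their
    \<open>ess_norm\<close> could be a default value.\<close>
  have quot: "AE t in lebesgue. t \<in> {t0..} \<longrightarrow> \<bar>f t / d t\<bar> \<le> Kf / d0"
    if "AE t in lebesgue. t \<in> {t0..} \<longrightarrow> \<bar>f t\<bar> \<le> Kf" "\<And>t. t \<ge> t0 \<Longrightarrow> d t \<ge> d0" "d0 > 0" for f d :: "real \<Rightarrow> real" and Kf d0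
    using that(1)
  proof eventually_elim
    case (elim t)
    then show ?case using that(2)[of t] \<open>d0 > 0\<close> by (auto simp: abs_divide intro!: frac_le)
  qed
  from assms(22) show ?thesis
  proof
    define b0 where "b0 t = min (b t) (1 / (\<tau> * exp 1))" for t
    define \<alpha> \<kappa> where "\<alpha> = ess_norm t0 (\<lambda>t. a t / b0 t)" and "\<kappa> = ess_norm t0 (\<lambda>t. (b t - b0 t) / b0 t)"
    \<comment> \<open>The uniform positive lower bound of \<open>b0\<close>, used as
      \<open>c0\<close>.\<close>
    define \<beta>0 where "\<beta>0 = min \<beta> (1 / (\<tau> * exp 1))"
    assume "let b0 = (\<lambda>t. min (b t) (1 / (\<tau> * exp 1))) in
            ess_norm t0 (\<lambda>t. a t / b0 t) * (ess_norm t0 b / (1 - ess_norm t0 a))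
              + ess_norm t0 (\<lambda>t. (b t - b0 t) / b0 t) < 1"
    \<comment> \<open>With \<open>\<theta> = \<tau>\<close> no delay exceeds
      \<open>\<theta>\<close>, so the argument is not moved and \<open>\<rho> = 0\<close>.\<close>
    then have small: "(\<alpha> + 0) * B / (1 - A) + \<kappa> < 1"
      by (simp add: Let_def \<alpha>_def \<kappa>_def b0_def A_def B_def)
    have \<beta>0: "\<beta>0 > 0" "\<And>t. t \<ge> t0 \<Longrightarrow> b0 t \<ge> \<beta>0"
      using \<beta> \<tau> b_ge by (auto simp: \<beta>0_def b0_def min_le_iff_disj)
    have [measurable]: "b0 \<in> borel_measurable (lebesgue_on {t0..})" unfolding b0_def by measurable
    have m1: "(\<lambda>t. a t / b0 t) \<in> borel_measurable (lebesgue_on {t0..})"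
      and m2: "(\<lambda>t. (b t - b0 t) / b0 t) \<in> borel_measurable (lebesgue_on {t0..})"
      by measurable
    have b_b0: "AE t in lebesgue. t \<in> {t0..} \<longrightarrow> \<bar>b t - b0 t\<bar> \<le> B"
      using B
    proof eventually_elim
      case (elim t)
      show ?case
      proof
        assume "t \<in> {t0..}"
        with elim \<beta>0(1) \<beta>0(2)[of t] show "\<bar>b t - b0 t\<bar> \<le> B" by (auto simp: b0_def)
      qed
    qed
    have bd1: "AE t in lebesgue. t \<in> {t0..} \<longrightarrow> \<bar>a t / b0 t\<bar> \<le> A / \<beta>0"
      by (rule quot[OF A(3) _ \<beta>0(1)]) (rule \<beta>0(2))
    have bd2: "AE t in lebesgue. t \<in> {t0..} \<longrightarrow> \<bar>(b t - b0 t) / b0 t\<bar> \<le> B / \<beta>0"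
      by (rule quot[OF b_b0 _ \<beta>0(1)]) (rule \<beta>0(2))
    note \<alpha> = AE_le_ess_norm[OF m1 bd1, folded \<alpha>_def] ess_norm_nonneg[OF m1 bd1, folded \<alpha>_def]
    note \<kappa> = AE_le_ess_norm[OF m2 bd2, folded \<kappa>_def] ess_norm_nonneg[OF m2 bd2, folded \<kappa>_def]
    show ?thesis
    proof (rule neutral_exponentially_stableI[OF \<open>t0 \<ge> 0\<close> _ _ _ _ _ _ \<tau> \<beta>0(1) A(1) less_imp_le[OF B0] \<alpha>(2) \<kappa>(2) order_refl less_imp_le[OF \<tau>] A(2) small])
      show "AE t in lebesgue. t \<in> {t0..} \<longrightarrow>
        \<bar>a t\<bar> \<le> A \<and> b t \<le> B \<and> \<beta>0 \<le> b0 t \<and> b0 t \<le> 1 / (\<tau> * exp 1) \<and> b0 t \<le> b t \<and>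
        \<bar>a t\<bar> \<le> \<alpha> * b0 t \<and> b t - b0 t \<le> \<kappa> * b0 t \<and> t - h t - \<tau> \<le> 0"
        using A(3) B \<alpha>(1) \<kappa>(1)
      proof eventually_elim
        case (elim t)
        show ?case
        proof
          assume t: "t \<in> {t0..}"
          then have b0t: "\<beta>0 \<le> b0 t" "b0 t > 0" using \<beta>0(1) \<beta>0(2)[of t] by auto
          have "\<bar>a t\<bar> \<le> \<alpha> * b0 t" using elim t b0t by (simp add: abs_divide pos_divide_le_eq)
          moreover have "\<bar>(b t - b0 t) / b0 t\<bar> \<le> \<kappa>" using elim t by blast
          then have "(b t - b0 t) / b0 t \<le> \<kappa>" by (rule abs_le_D1)
          then have "b t - b0 t \<le> \<kappa> * b0 t" using b0t by (simp add: pos_divide_le_eq)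
          ultimately show "\<bar>a t\<bar> \<le> A \<and> b t \<le> B \<and> \<beta>0 \<le> b0 t \<and> b0 t \<le> 1 / (\<tau> * exp 1) \<and> b0 t \<le> b t \<and>
            \<bar>a t\<bar> \<le> \<alpha> * b0 t \<and> b t - b0 t \<le> \<kappa> * b0 t \<and> t - h t - \<tau> \<le> 0"
            using elim t b0t assms(19)[of t] by (auto simp: b0_def)
        qed
      qed
    qed (erule g_le assms(17) h_le assms(19) assms(15))+
  next
    \<comment> \<open>The value for which \<open>1 / (\<theta> * exp 1) = B\<close>: then
      \<open>b\<close> itself is an admissible \<open>c\<close>, giving \<open>\<kappa> = 0\<close>,
      and only the part of the delay beyond \<open>\<theta>\<close> contributes.\<close>
    define \<theta> where "\<theta> = 1 / (B * exp 1)"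
    define \<alpha> \<rho> where "\<alpha> = ess_norm t0 (\<lambda>t. a t / b t)" and "\<rho> = ess_norm t0 (\<lambda>t. max (t - h t - \<theta>) 0)"
    have \<theta>: "\<theta> > 0" "1 / (\<theta> * exp 1) = B" using B0 by (auto simp: \<theta>_def)
    assume "ess_norm t0 b *
            (ess_norm t0 (\<lambda>t. a t / b t)
              + ess_norm t0 (\<lambda>t. max (t - h t - 1 / (ess_norm t0 b * exp 1)) 0))
            < 1 - ess_norm t0 a"
    then have "B * (\<alpha> + \<rho>) < 1 - A" by (simp add: \<alpha>_def \<rho>_def \<theta>_def A_def B_def)
    then have small: "(\<alpha> + \<rho>) * B / (1 - A) + 0 < 1" using A(2) by (simp add: mult.commute)
    have m1: "(\<lambda>t. a t / b t) \<in> borel_measurable (lebesgue_on {t0..})" by measurable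
    have [measurable]: "(\<lambda>t. t) \<in> borel_measurable (lebesgue_on {t0..})"
      by (intro measurable_restrict_space1 measurable_completion) simp
    have m2: "(\<lambda>t. max (t - h t - \<theta>) 0) \<in> borel_measurable (lebesgue_on {t0..})" by measurable
    have bd1: "AE t in lebesgue. t \<in> {t0..} \<longrightarrow> \<bar>a t / b t\<bar> \<le> A / \<beta>"
      by (rule quot[OF A(3) _ \<beta>]) (rule b_ge)
    have bd2: "AE t in lebesgue. t \<in> {t0..} \<longrightarrow> \<bar>max (t - h t - \<theta>) 0\<bar> \<le> \<tau>"
    proof (intro AE_I2 impI)
      fix t assume "t \<in> {t0..}"
      then show "\<bar>max (t - h t - \<theta>) 0\<bar> \<le> \<tau>" using assms(19)[of t] \<theta>(1) \<tau> by auto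
    qed
    note \<alpha> = AE_le_ess_norm[OF m1 bd1, folded \<alpha>_def] ess_norm_nonneg[OF m1 bd1, folded \<alpha>_def]
    note \<rho> = AE_le_ess_norm[OF m2 bd2, folded \<rho>_def] ess_norm_nonneg[OF m2 bd2, folded \<rho>_def]
    show ?thesis
    proof (rule neutral_exponentially_stableI[OF \<open>t0 \<ge> 0\<close> _ _ _ _ _ _ \<theta>(1) \<beta> A(1) less_imp_le[OF B0] \<alpha>(2) order_refl \<rho>(2) less_imp_le[OF \<tau>] A(2) small])
      show "AE t in lebesgue. t \<in> {t0..} \<longrightarrow>
        \<bar>a t\<bar> \<le> A \<and> b t \<le> B \<and> \<beta> \<le> b t \<and> b t \<le> 1 / (\<theta> * exp 1) \<and> b t \<le> b t \<and>
        \<bar>a t\<bar> \<le> \<alpha> * b t \<and> b t - b t \<le> 0 * b t \<and> t - h t - \<theta> \<le> \<rho>"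
        using A(3) B \<alpha>(1) \<rho>(1)
      proof eventually_elim
        case (elim t)
        show ?case
        proof
          assume t: "t \<in> {t0..}"
          then have bt: "\<beta> \<le> b t" "b t > 0" using \<beta> b_ge[of t] by auto
          have "\<bar>a t\<bar> \<le> \<alpha> * b t" using elim t bt by (simp add: abs_divide pos_divide_le_eq)
          then show "\<bar>a t\<bar> \<le> A \<and> b t \<le> B \<and> \<beta> \<le> b t \<and> b t \<le> 1 / (\<theta> * exp 1) \<and> b t \<le> b t \<and>
            \<bar>a t\<bar> \<le> \<alpha> * b t \<and> b t - b t \<le> 0 * b t \<and> t - h t - \<theta> \<le> \<rho>"
            using elim t bt unfolding \<theta>(2) by auto
        qed
      qed
    qed (erule g_le assms(17) h_le assms(19) assms(15))+
  qed
qed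

end
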